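(* For any $K \in \mathcal{K}^3(D_{2d})$, it holds that $$|K|\,|K^\circ| \;\geq\; |\triangle|\,|\triangle^\circ| = \frac{64}{9},$$ with equality if and only if $K$ is a linear image of $\triangle$ or $\triangle^\circ$ which is invariant under the group $D_{2d}$.
   Context: A convex body in $\mathbb{R}^3$ is a compact convex set with nonempty interior, and $|\cdot|$ denotes the $3$-dimensional Lebesgue measure. For a convex body $K$ with the origin $o$ in its interior, $K^\circ := \{ y \in \mathbb{R}^3 : y \cdot x \leq 1 \text{ for all } x \in K\}$ is the polar body with respect to $o$. $D_{2d}$ is the subgroup of $O(3)$ of order eight generated by $$\begin{pmatrix} 0 & -1 & 0 \\ 1 & 0 & 0 \\ 0 & 0 & -1 \end{pmatrix} \quad\text{and}\quad \begin{pmatrix} 1 & 0 & 0 \\ 0 & -1 & 0 \\ 0 & 0 & 1 \end{pmatrix}.$$ $\mathcal{K}^3(D_{2d})$ is the set of convex bodies $K\subset\mathbb{R}^3$ with $gK=K$ for all $g \in D_{2d}$; since the only fixed point of $D_{2d}$ is $o$, every such $K$ contains $o$ in its interior. $\triangle$ denotes a regular tetrahedron (regular $3$-simplex) in $\mathbb{R}^3$ with centroid $o$. A linear image means the image under a nonsingular linear map of $\mathbb{R}^3$. *)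

theory Defs
  imports "HOL-Analysis.Analysis" "HOL-Algebra.Generated_Groups"
begin

definition convex_body :: "(real^3) set \<Rightarrow> bool" where
  "convex_body K \<longleftrightarrow> compact K \<and> convex K \<and> interior K \<noteq> {}"

definition polar_body :: "(real^3) set \<Rightarrow> (real^3) set" where
  "polar_body K = {y. \<forall>x\<in>K. y \<bullet> x \<le> 1}"

abbreviation vol :: "(real^3) set \<Rightarrow> real" where
  "vol S \<equiv> measure lebesgue S"

definition O3 :: "(real^3^3) monoid" where
  "O3 = \<lparr>carrier = {A. orthogonal_matrix A}, mult = (**), one = mat 1\<rparr>"

text \<open>Matrices are given by their lists of rows.\<close>

definition D2d :: "(real^3^3) set" where
  "D2d = generate O3
     {vector [vector [0, -1, 0], vector [1, 0, 0], vector [0, 0, -1]],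
      vector [vector [1, 0, 0], vector [0, -1, 0], vector [0, 0, 1]]}"

definition invariant_under :: "(real^3^3) set \<Rightarrow> (real^3) set \<Rightarrow> bool" where
  "invariant_under G K \<longleftrightarrow> (\<forall>g\<in>G. (\<lambda>x. g *v x) ` K = K)"

definition invariant_convex_bodies :: "(real^3^3) set \<Rightarrow> (real^3) set set" where
  "invariant_convex_bodies G = {K. convex_body K \<and> invariant_under G K}"

text \<open>
  A regular tetrahedron with centroid at the origin, with no constraint on its edge
  length or position; the centroid of a simplex is the mean of its vertices.
\<close>

definition centred_regular_tetrahedron :: "(real^3) set \<Rightarrow> bool" where
  "centred_regular_tetrahedron T \<longleftrightarrow>
     (\<exists>V. card V = 4 \<and> \<not> affine_dependent V \<and> T = convex hull V \<and>
          (\<exists>s. \<forall>v\<in>V. \<forall>w\<in>V. v \<noteq> w \<longrightarrow> dist v w = s) \<and>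
          (1 / 4) *\<^sub>R (\<Sum>v\<in>V. v) = 0)"

definition linear_image_of :: "(real^3) set \<Rightarrow> (real^3) set \<Rightarrow> bool" where
  "linear_image_of K T \<longleftrightarrow> (\<exists>f. linear f \<and> bij f \<and> K = f ` T)"

end

theory Submission
  imports Defs
begin

text \<open>
  Write \<open>L\<close> for the polar body of \<open>K\<close>. The group contains the reflections in the planes
  \<open>x = 0\<close> and \<open>y = 0\<close> and the half-turn \<open>(x, y, z) \<mapsto> (y, x, -z)\<close>, so the wedge \<open>0 \<le> x \<le> y\<close> is a
  fundamental domain and contains one eighth of the volume of \<open>K\<close> and of \<open>L\<close>. Averaging over the
  group provides pairs of boundary points with inner product one: \<open>(0, 0, c)\<close> in \<open>K\<close> with
  \<open>(0, 0, d)\<close> in \<open>L\<close>, and \<open>n = (t, t, 0)\<close> in \<open>K\<close> with \<open>(s, s, 0)\<close> in \<open>L\<close>. A third pair lies in the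
  mirror plane \<open>x = 0\<close>. There \<open>p = (0, P, c * \<zeta>)\<close> is chosen to maximise \<open>y\<^sup>2 / (c\<^sup>2 + z\<^sup>2)\<close> over \<open>K\<close>,
  which puts its partner \<open>(0, Q, -d * \<zeta>)\<close> into \<open>L\<close>; this is lemma \<open>aligned_polar_pair_exists\<close>.

  The plane through the origin, \<open>n\<close> and \<open>p\<close> cuts the wedge into two sectors \<open>\<epsilon> = 1, -1\<close>; the
  corresponding plane for \<open>L\<close> does the same there. Let \<open>V \<epsilon>\<close> and \<open>W \<epsilon>\<close> be the volumes of \<open>K\<close> and
  \<open>L\<close> in their sectors. The argument is Meyer's for unconditional bodies, applied to each sector.
  For a point \<open>X = (0, u, z)\<close> of \<open>K\<close>, the tetrahedra that join the edge from the origin to \<open>n\<close>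
  with \<open>p, X\<close> and with \<open>X, (0, 0, \<epsilon> * c)\<close> have a total signed volume that is linear in \<open>X\<close> and at
  most \<open>V \<epsilon>\<close> (\<open>support_le_volume\<close>). This linear functional divided by \<open>V \<epsilon>\<close> is therefore a
  point of \<open>L\<close>, and the same bound for \<open>L\<close> at this point reads \<open>V \<epsilon> * W \<epsilon> \<ge> 1 / 36\<close>
  (\<open>sector_product\<close>). The opposite signs of the heights of \<open>p\<close> and its partner are what makes the
  constant the same in both sectors. By Cauchy--Schwarz,
  \<open>(V 1 + V (-1)) * (W 1 + W (-1)) \<ge> 4 / 36\<close>, and the factor \<open>8 * 8\<close> gives \<open>64 / 9\<close>.

  In the case of equality with \<open>\<bar>\<zeta>\<bar> < 1\<close>, every sector of \<open>K\<close> and of \<open>L\<close> is the union of two explicit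
  tetrahedra. Then no point of the wedge off the mirror plane \<open>x = 0\<close> has maximal height, so convexity
  and the half-turn force one of the two ends of the section \<open>x = 0\<close> of \<open>K\<close> to be a point, and
  similarly for \<open>L\<close>. A pointed end determines the sector volumes (\<open>volume_of_pointed_end\<close>), and
  together the values contradict \<open>V 1 * W 1 = 1 / 36\<close>. Hence \<open>\<zeta> = 1\<close> or \<open>\<zeta> = -1\<close>, when the orbits of
  \<open>p\<close> and of its partner span tetrahedra that are polar to each other, and \<open>K\<close> is the first
  of them. All tetrahedra with centroid at the origin are linear images of each other, and
  the volume product is invariant under linear maps.
\<close>

section \<open>Coordinates and volumes in three-space\<close>

abbreviation pt :: "real \<Rightarrow> real \<Rightarrow> real \<Rightarrow> real^3" where
  "pt x y z \<equiv> vector [x, y, z]"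

lemma pt_eta: "pt (X $ 1) (X $ 2) (X $ 3) = X"
  by (simp add: vec_eq_iff forall_3)

lemma pt_ops:
  "pt a b c + pt x y z = pt (a + x) (b + y) (c + z)"
  "r *\<^sub>R pt x y z = pt (r * x) (r * y) (r * z)"
  "- pt x y z = pt (- x) (- y) (- z)"
  "0 = pt 0 0 0"
  by (simp_all add: vec_eq_iff forall_3)

lemma pt_eq_iff: "pt a b c = pt x y z \<longleftrightarrow> a = x \<and> b = y \<and> c = z"
  by (simp add: vec_eq_iff forall_3)

lemma inner_vec3: "X \<bullet> (Y :: real^3) = X $ 1 * Y $ 1 + X $ 2 * Y $ 2 + X $ 3 * Y $ 3"
  by (simp add: inner_vec_def sum_3)

lemma measure_halfspace_split:
  fixes S :: "'a::euclidean_space set"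
  assumes S: "S \<in> lmeasurable" and a: "a \<noteq> 0"
  shows "measure lebesgue S =
    measure lebesgue (S \<inter> {x. 0 \<le> a \<bullet> x}) + measure lebesgue (S \<inter> {x. a \<bullet> x \<le> 0})"
proof -
  have m: "S \<inter> {x. 0 \<le> a \<bullet> x} \<in> lmeasurable" "S \<inter> {x. a \<bullet> x \<le> 0} \<in> lmeasurable"
    by (intro fmeasurable_Int_fmeasurable[OF S], simp add: closed_halfspace_le closed_halfspace_ge)+
  have "negligible ((S \<inter> {x. 0 \<le> a \<bullet> x}) \<inter> (S \<inter> {x. a \<bullet> x \<le> 0}))"
    by (rule negligible_subset[OF negligible_hyperplane[of a 0]]) (use a in auto)
  then have "measure lebesgue ((S \<inter> {x. 0 \<le> a \<bullet> x}) \<inter> (S \<inter> {x. a \<bullet> x \<le> 0})) = 0"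
    by (rule negligible_imp_measure0)
  moreover have "S = (S \<inter> {x. 0 \<le> a \<bullet> x}) \<union> (S \<inter> {x. a \<bullet> x \<le> 0})"
    by auto
  ultimately show ?thesis
    using measure_Un3[OF m] by simp
qed

text \<open>
  A linear involution has determinant \<open>1\<close> or \<open>-1\<close>, so it carries the part of \<open>S\<close> on
  one side of the plane to a part of equal volume on the other side.
\<close>

lemma measure_halve_by_involution:
  fixes S :: "(real^3) set"
  assumes S: "S \<in> lmeasurable" and a: "a \<noteq> 0" and g: "linear g"
    and inv: "\<And>x. g (g x) = x" and gS: "\<And>x. x \<in> S \<Longrightarrow> g x \<in> S"
    and flip: "\<And>x. a \<bullet> g x = - (a \<bullet> x)"
  shows "measure lebesgue S = 2 * measure lebesgue (S \<inter> {x. 0 \<le> a \<bullet> x})"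
proof -
  have m: "S \<inter> {x. 0 \<le> a \<bullet> x} \<in> lmeasurable"
    by (intro fmeasurable_Int_fmeasurable[OF S]) (simp add: closed_halfspace_ge)
  have "matrix g ** matrix g = mat 1"
    using matrix_compose[OF g g] inv by (simp add: o_def matrix_id_mat_1 flip: id_def)
  then have "det (matrix g) * det (matrix g) = 1"
    by (metis det_I det_mul)
  then have d: "\<bar>det (matrix g)\<bar> = 1"
    by (metis abs_1 abs_mult abs_mult_self_eq abs_square_eq_1 power2_eq_square)
  have "g ` (S \<inter> {x. 0 \<le> a \<bullet> x}) = S \<inter> {x. a \<bullet> x \<le> 0}"
  proof (intro equalityI subsetI)
    fix x assume "x \<in> S \<inter> {x. a \<bullet> x \<le> 0}"
    then have "g x \<in> S \<inter> {x. 0 \<le> a \<bullet> x}" using gS flip by auto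
    then show "x \<in> g ` (S \<inter> {x. 0 \<le> a \<bullet> x})" using inv by (metis imageI)
  qed (use gS flip in auto)
  then have "measure lebesgue (S \<inter> {x. a \<bullet> x \<le> 0}) = measure lebesgue (S \<inter> {x. 0 \<le> a \<bullet> x})"
    using measure_linear_image[OF g m] d by simp
  then show ?thesis
    using measure_halfspace_split[OF S a] by simp
qed

text \<open>
  A point of \<open>D\<close> outside the closed set \<open>C\<close> would have a neighbourhood that misses \<open>C\<close>
  and meets the interior of \<open>D\<close> in an open set, whose positive volume \<open>C\<close> lacks. In the
  equality discussion this turns equalities of volumes into equalities of sets.
\<close>

lemma compact_convex_full_subset_eq:
  fixes C D :: "'a::euclidean_space set"
  assumes C: "compact C" and D: "compact D" "convex D" and sub: "C \<subseteq> D"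
    and eq: "measure lebesgue C = measure lebesgue D" and pos: "0 < measure lebesgue D"
  shows "C = D"
proof (rule ccontr)
  assume "C \<noteq> D"
  then obtain x where x: "x \<in> D" "x \<notin> C" using sub by auto
  have "interior D \<noteq> {}"
    using negligible_convex_interior[OF D(2)] pos negligible_imp_measure0[of D] by auto
  then have "x \<in> closure (interior D)"
    using convex_closure_interior[OF D(2)] x closure_subset by blast
  moreover have "open (- C)" using C by (simp add: compact_imp_closed open_Compl)
  ultimately have ne: "interior D \<inter> - C \<noteq> {}"
    using x by (metis ComplI Int_commute open_Int_closure_eq_empty disjoint_iff)
  define U where "U = interior D \<inter> - C"
  have U: "open U" "U \<noteq> {}" using \<open>open (- C)\<close> ne unfolding U_def by auto
  have mD: "D \<in> lmeasurable" and mC: "C \<in> lmeasurable" using C D lmeasurable_compact by auto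
  have "bounded U" unfolding U_def
    using D(1) compact_imp_bounded bounded_subset interior_subset by (metis inf.coboundedI1)
  then have mU: "U \<in> lmeasurable" using U lmeasurable_open by blast
  have "measure lebesgue U > 0"
    using open_not_negligible[OF U] negligible_iff_measure0[OF mU] by (simp add: zero_less_measure_iff)
  moreover have "measure lebesgue (C \<union> U) = measure lebesgue C + measure lebesgue U"
    using measure_Un3[OF mC mU] unfolding U_def
    by (metis Diff_disjoint Diff_eq Int_commute Int_left_commute inf_bot_right measure_empty diff_zero)
  moreover have "measure lebesgue (C \<union> U) \<le> measure lebesgue D"
    using mD mC mU sub interior_subset[of D] unfolding U_def
    by (intro measure_mono_fmeasurable) (auto intro!: sets.Un fmeasurableD)
  ultimately show False using eq by simp
qed

definition triple_product :: "real^3 \<Rightarrow> real^3 \<Rightarrow> real^3 \<Rightarrow> real" where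
  "triple_product a b c = a $ 1 * (b $ 2 * c $ 3 - b $ 3 * c $ 2) + a $ 2 * (b $ 3 * c $ 1 - b $ 1 * c $ 3)
     + a $ 3 * (b $ 1 * c $ 2 - b $ 2 * c $ 1)"

lemma Basis_real3: "(Basis :: (real^3) set) = {axis 1 1, axis 2 1, axis 3 1}"
  unfolding Basis_vec_def by (auto simp: UNIV_3)

text \<open>
  The tetrahedron is the image of the standard simplex under the linear map with columns
  \<open>a\<close>, \<open>b\<close>, \<open>c\<close>; when these are linearly dependent, both sides vanish.
\<close>

lemma measure_tetrahedron:
  "measure lebesgue (convex hull {0, a, b, c}) = \<bar>triple_product a b c\<bar> / 6"
proof -
  define f where "f = (\<lambda>x::real^3. x $ 1 *\<^sub>R a + x $ 2 *\<^sub>R b + x $ 3 *\<^sub>R c)"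
  have lin: "linear f"
    unfolding f_def by (auto intro!: linearI simp: algebra_simps)
  have cp: "compact (convex hull insert 0 (Basis :: (real^3) set))"
    by (simp add: finite_imp_compact_convex_hull)
  have "f ` (convex hull insert 0 Basis) = convex hull (f ` insert 0 Basis)"
    by (rule convex_hull_linear_image[OF lin])
  also have "f ` insert 0 Basis = {0, a, b, c}"
    by (simp add: Basis_real3 f_def axis_def)
  finally have "measure lebesgue (convex hull {0, a, b, c}) =
      \<bar>det (matrix f)\<bar> * measure lebesgue (convex hull insert 0 (Basis :: (real^3) set))"
    using measure_linear_image[OF lin lmeasurable_compact[OF cp]] by simp
  also have "det (matrix f) = triple_product a b c"
    by (simp add: det_3 matrix_def f_def axis_def triple_product_def algebra_simps)
  also have "measure lebesgue (convex hull insert 0 (Basis :: (real^3) set)) = 1 / 6"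
    using content_std_simplex[where 'a = "real^3"] cp
    by (simp add: measure_completion borel_compact fact_numeral)
  finally show ?thesis by simp
qed

lemma tetrahedron_points:
  fixes a b c x :: "'a::real_vector"
  assumes "x \<in> convex hull {0, a, b, c}"
  obtains r s t where "0 \<le> r" "0 \<le> s" "0 \<le> t" "r + s + t \<le> (1::real)"
    "x = r *\<^sub>R a + s *\<^sub>R b + t *\<^sub>R c"
proof -
  define H where "H = {x. \<exists>r s t. 0 \<le> r \<and> 0 \<le> s \<and> 0 \<le> t \<and> r + s + t \<le> (1::real) \<and>
    x = r *\<^sub>R a + s *\<^sub>R b + t *\<^sub>R c}"
  have "convex H"
  proof (rule convexI)
    fix x y and u v :: real
    assume "x \<in> H" "y \<in> H" and uv: "0 \<le> u" "0 \<le> v" "u + v = 1"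
    then obtain r s t r' s' t' where
      *: "0 \<le> r" "0 \<le> s" "0 \<le> t" "r + s + t \<le> 1" "x = r *\<^sub>R a + s *\<^sub>R b + t *\<^sub>R c"
      "0 \<le> r'" "0 \<le> s'" "0 \<le> t'" "r' + s' + t' \<le> 1" "y = r' *\<^sub>R a + s' *\<^sub>R b + t' *\<^sub>R c"
      unfolding H_def by auto
    have "u * (r + s + t) + v * (r' + s' + t') \<le> u * 1 + v * 1"
      using * uv by (intro add_mono mult_left_mono) auto
    then have "(u * r + v * r') + (u * s + v * s') + (u * t + v * t') \<le> 1"
      using uv by (simp add: algebra_simps)
    moreover have "u *\<^sub>R x + v *\<^sub>R y = (u * r + v * r') *\<^sub>R a + (u * s + v * s') *\<^sub>R b + (u * t + v * t') *\<^sub>R c"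
      using * by (simp add: algebra_simps)
    moreover have "0 \<le> u * r + v * r'" "0 \<le> u * s + v * s'" "0 \<le> u * t + v * t'"
      using * uv by auto
    ultimately show "u *\<^sub>R x + v *\<^sub>R y \<in> H" unfolding H_def by blast
  qed
  moreover have "{0, a, b, c} \<subseteq> H"
  proof -
    have H: "r *\<^sub>R a + s *\<^sub>R b + t *\<^sub>R c \<in> H"
      if "0 \<le> r" "0 \<le> s" "0 \<le> t" "r + s + t \<le> 1" for r s t :: real
      using that unfolding H_def by blast
    show ?thesis
      using H[of 0 0 0] H[of 1 0 0] H[of 0 1 0] H[of 0 0 1] by simp
  qed
  ultimately have "convex hull {0, a, b, c} \<subseteq> H" by (rule hull_minimal[rotated])
  with assms that show ?thesis unfolding H_def by auto
qed

section \<open>Polar bodies\<close>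

lemma polar_body_inner: "y \<in> polar_body K \<Longrightarrow> x \<in> K \<Longrightarrow> y \<bullet> x \<le> 1"
  by (simp add: polar_body_def)

lemma convex_polar_body: "convex (polar_body K)"
  unfolding polar_body_def
  by (rule convexI) (auto simp: inner_left_distrib intro!: convex_bound_le)

lemma closed_polar_body: "closed (polar_body K)"
proof -
  have "polar_body K = (\<Inter>x\<in>K. {y. x \<bullet> y \<le> 1})"
    by (auto simp: polar_body_def inner_commute)
  then show ?thesis by (auto intro!: closed_INT closed_halfspace_le)
qed

lemma bounded_polar_body:
  assumes "0 \<in> interior K"
  shows "bounded (polar_body K)"
proof -
  obtain e where e: "e > 0" "cball 0 e \<subseteq> K" using assms by (meson mem_interior_cball)
  have "norm y \<le> 1 / e" if "y \<in> polar_body K" for y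
  proof (cases "y = 0")
    case False
    have "(e / norm y) *\<^sub>R y \<in> K" using e False by (intro subsetD[OF e(2)]) auto
    then have "y \<bullet> ((e / norm y) *\<^sub>R y) \<le> 1"
      by (rule polar_body_inner[OF that])
    then have "e * norm y \<le> 1"
      using False by (simp add: power2_norm_eq_inner[symmetric] power2_eq_square)
    then show ?thesis using e by (simp add: field_simps)
  qed (use e in auto)
  then show ?thesis by (auto simp: bounded_iff)
qed

lemma bipolar:
  assumes "closed K" "convex K" "0 \<in> K"
  shows "polar_body (polar_body K) = K"
proof (intro equalityI subsetI)
  fix x assume x: "x \<in> polar_body (polar_body K)"
  show "x \<in> K"
  proof (rule ccontr)
    assume "x \<notin> K"
    then obtain a b where ab: "a \<bullet> x < b" "\<And>y. y \<in> K \<Longrightarrow> b < a \<bullet> y"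
      using separating_hyperplane_closed_point[OF assms(2,1)] by blast
    have b: "b < 0" using ab(2)[OF assms(3)] by simp
    \<comment> \<open>As \<open>b < 0\<close>, dividing the separating functional by \<open>b\<close> reverses the inequalities: it
      exceeds 1 at \<open>x\<close> and stays below 1 on \<open>K\<close>.\<close>
    have "(1 / b) *\<^sub>R a \<in> polar_body K"
      unfolding polar_body_def using ab(2) b by (auto simp: field_simps less_imp_le)
    then have "x \<bullet> ((1 / b) *\<^sub>R a) \<le> 1"
      using x unfolding polar_body_def by blast
    then show False using ab(1) b by (simp add: field_simps inner_commute)
  qed
qed (auto simp: polar_body_def inner_commute)

text \<open>
  The form \<open>K\<^sup>\<circ> = f\<^sup>* ((f K)\<^sup>\<circ>)\<close> avoids the inverse map: it gives the invariance of the volume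
  product directly, since \<open>f\<close> and its adjoint have the same determinant.
\<close>

lemma polar_body_linear_image:
  fixes f :: "real^3 \<Rightarrow> real^3"
  assumes "linear f" "bij f"
  shows "polar_body K = adjoint f ` polar_body (f ` K)"
proof (intro equalityI subsetI)
  interpret f: linear f by fact
  obtain g where g: "linear g" "\<And>x. g (f x) = x"
    using linear_injective_isomorphism[OF assms(1) bij_is_inj[OF assms(2)]] by auto
  fix y assume y: "y \<in> polar_body K"
  have "adjoint f (adjoint g y) = y"
    by (rule vector_eq_rdot[THEN iffD1])
      (simp add: adjoint_clauses(2)[OF assms(1)] adjoint_clauses(2)[OF g(1)] g(2))
  moreover have "adjoint g y \<in> polar_body (f ` K)"
    using y g(2) by (auto simp: polar_body_def adjoint_clauses(2)[OF g(1)] fun_eq_iff)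
  ultimately show "y \<in> adjoint f ` polar_body (f ` K)" by (metis imageI)
next
  fix y assume "y \<in> adjoint f ` polar_body (f ` K)"
  then show "y \<in> polar_body K"
    by (auto simp: polar_body_def adjoint_clauses(2)[OF assms(1)])
qed

section \<open>Bodies with the symmetry of a tetragonal disphenoid\<close>

text \<open>
  Two mirror reflections and the half-turn about the line \<open>x = y, z = 0\<close>. These involutions
  generate the group, and they are the ones used for averaging and for halving volumes.
\<close>

definition d2d_symmetric :: "(real^3) set \<Rightarrow> bool" where
  "d2d_symmetric K \<longleftrightarrow> (\<forall>x y z. pt x y z \<in> K \<longrightarrow>
     pt (- x) y z \<in> K \<and> pt x (- y) z \<in> K \<and> pt y x (- z) \<in> K)"

lemma d2d_symmetricD:
  assumes "d2d_symmetric K" "pt x y z \<in> K"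
  shows "pt (- x) y z \<in> K" "pt x (- y) z \<in> K" "pt y x (- z) \<in> K"
  using assms unfolding d2d_symmetric_def by blast+

lemma d2d_symmetric_polar:
  assumes "d2d_symmetric K"
  shows "d2d_symmetric (polar_body K)"
  unfolding d2d_symmetric_def
proof (intro allI impI)
  fix x y z assume *: "pt x y z \<in> polar_body K"
  have "x * a + y * b + z * c \<le> 1" if "pt a b c \<in> K" for a b c
    using polar_body_inner[OF * that] by (simp add: inner_vec3)
  note all = this this[OF d2d_symmetricD(1)[OF assms]] this[OF d2d_symmetricD(2)[OF assms]]
    this[OF d2d_symmetricD(3)[OF assms]]
  have "pt (- x) y z \<bullet> X \<le> 1 \<and> pt x (- y) z \<bullet> X \<le> 1 \<and> pt y x (- z) \<bullet> X \<le> 1"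
    if "X \<in> K" for X
    using all[of "X $ 1" "X $ 2" "X $ 3", unfolded pt_eta, OF that]
    by (simp add: inner_vec3 algebra_simps)
  then show "pt (- x) y z \<in> polar_body K \<and> pt x (- y) z \<in> polar_body K \<and> pt y x (- z) \<in> polar_body K"
    unfolding polar_body_def by blast
qed

lemma convex_midpoint: "convex K \<Longrightarrow> x \<in> K \<Longrightarrow> y \<in> K \<Longrightarrow> (1 / 2 :: real) *\<^sub>R x + (1 / 2) *\<^sub>R y \<in> K"
  by (rule convexD) auto

text \<open>
  Averaging over a subgroup projects onto its fixed space without leaving the body: onto the
  mirror plane \<open>x = 0\<close>, onto the vertical axis, and onto the axis of the half-turn.
\<close>

lemma d2d_symmetric_averages:
  assumes K: "convex K" "d2d_symmetric K" and X: "pt x y z \<in> K"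
  shows "pt 0 \<bar>y\<bar> z \<in> K" "pt 0 0 z \<in> K" "pt ((x + y) / 2) ((x + y) / 2) 0 \<in> K"
proof -
  have A: "pt 0 y z \<in> K"
    using convex_midpoint[OF K(1) X d2d_symmetricD(1)[OF K(2) X]] by (simp add: pt_ops)
  then show "pt 0 \<bar>y\<bar> z \<in> K"
    using d2d_symmetricD(2)[OF K(2) A] by (simp add: abs_if)
  show "pt 0 0 z \<in> K"
    using convex_midpoint[OF K(1) A d2d_symmetricD(2)[OF K(2) A]] by (simp add: pt_ops)
  show "pt ((x + y) / 2) ((x + y) / 2) 0 \<in> K"
    using convex_midpoint[OF K(1) X d2d_symmetricD(3)[OF K(2) X]]
    by (simp add: pt_ops add_divide_distrib add.commute)
qed

lemma closed_halfspace_inner: "closed {x. 0 \<le> a \<bullet> (x :: real^3)}"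
  by (simp add: closed_halfspace_ge)

text \<open>
  The wedge \<open>0 \<le> x \<le> y\<close> is a fundamental domain of the group of order eight: the reflections
  and the half-turn each halve the body.
\<close>

lemma d2d_symmetric_measure_wedge:
  assumes K: "compact K" "d2d_symmetric K"
  shows "measure lebesgue K = 8 * measure lebesgue (K \<inter> {X. 0 \<le> X $ 1 \<and> X $ 1 \<le> X $ 2})"
proof -
  have nz: "pt 1 0 0 \<noteq> 0" "pt 0 1 0 \<noteq> 0" "pt (- 1) 1 0 \<noteq> 0"
    by (simp_all add: vec_eq_iff forall_3)
  have sym: "pt (- (X $ 1)) (X $ 2) (X $ 3) \<in> K" "pt (X $ 1) (- (X $ 2)) (X $ 3) \<in> K"
    "pt (X $ 2) (X $ 1) (- (X $ 3)) \<in> K" if "X \<in> K" for X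
    using d2d_symmetricD[OF K(2), of "X $ 1" "X $ 2" "X $ 3"] that by (simp_all add: pt_eta)
  have lin: "linear (\<lambda>X. pt (- (X $ 1)) (X $ 2) (X $ 3))" "linear (\<lambda>X. pt (X $ 1) (- (X $ 2)) (X $ 3))"
    "linear (\<lambda>X. pt (X $ 2) (X $ 1) (- (X $ 3)))"
    by (auto intro!: linearI simp: pt_ops)
  define K1 where "K1 = K \<inter> {x. 0 \<le> pt 1 0 0 \<bullet> x}"
  define K2 where "K2 = K1 \<inter> {x. 0 \<le> pt 0 1 0 \<bullet> x}"
  have c: "compact K1" "compact K2"
    unfolding K2_def K1_def by (intro compact_Int_closed K closed_halfspace_inner)+
  have "measure lebesgue K = 2 * measure lebesgue K1"
    unfolding K1_def
    by (rule measure_halve_by_involution[OF lmeasurable_compact[OF K(1)] nz(1) lin(1)])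
      (auto simp: pt_eta sym inner_vec3)
  also have "measure lebesgue K1 = 2 * measure lebesgue K2"
    unfolding K2_def
    by (rule measure_halve_by_involution[OF lmeasurable_compact[OF c(1)] nz(2) lin(2)])
      (auto simp: K1_def pt_eta sym inner_vec3)
  also have "measure lebesgue K2 = 2 * measure lebesgue (K2 \<inter> {x. 0 \<le> pt (- 1) 1 0 \<bullet> x})"
    by (rule measure_halve_by_involution[OF lmeasurable_compact[OF c(2)] nz(3) lin(3)])
      (auto simp: K2_def K1_def pt_eta sym inner_vec3)
  also have "K2 \<inter> {x. 0 \<le> pt (- 1) 1 0 \<bullet> x} = K \<inter> {X. 0 \<le> X $ 1 \<and> X $ 1 \<le> X $ 2}"
    by (auto simp: K2_def K1_def inner_vec3)
  finally show ?thesis by simp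
qed

section \<open>Sector volumes of an aligned polar pair\<close>

text \<open>
  The half \<open>\<epsilon> = 1\<close> or \<open>\<epsilon> = -1\<close> of the wedge above or below the plane through the origin, the
  direction \<open>(1, 1, 0)\<close> and the point \<open>(0, P, c * \<zeta>)\<close>. Modulo \<open>(1, 1, 0)\<close> a point of the wedge
  becomes \<open>(0, y - x, z)\<close>, and the last condition is the sign of its cross product with
  \<open>(P, c * \<zeta>)\<close>.
\<close>

definition sector :: "real \<Rightarrow> real \<Rightarrow> real \<Rightarrow> real \<Rightarrow> (real^3) set" where
  "sector c P \<zeta> \<epsilon> = {X. 0 \<le> X $ 1 \<and> X $ 1 \<le> X $ 2 \<and> 0 \<le> \<epsilon> * (P * X $ 3 - c * \<zeta> * (X $ 2 - X $ 1))}"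

lemma sector_as_halfspaces:
  "sector c P \<zeta> \<epsilon> = {X. 0 \<le> pt 1 0 0 \<bullet> X} \<inter> {X. 0 \<le> pt (- 1) 1 0 \<bullet> X} \<inter>
     {X. 0 \<le> (\<epsilon> *\<^sub>R pt (c * \<zeta>) (- (c * \<zeta>)) P) \<bullet> X}"
  by (auto simp: sector_def inner_vec3 algebra_simps)

lemma closed_sector: "closed (sector c P \<zeta> \<epsilon>)"
  unfolding sector_as_halfspaces by (intro closed_Int closed_halfspace_inner)

lemma convex_sector: "convex (sector c P \<zeta> \<epsilon>)"
  unfolding sector_as_halfspaces by (intro convex_Int convex_halfspace_ge)

text \<open>
  A body \<open>K\<close> and its polar \<open>L\<close> with three pairs of points, one in each body: on the vertical
  axis, in the mirror plane \<open>x = 0\<close>, and on the axis of the half-turn. Each pair has inner product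
  one. The heights of the points in the mirror plane are opposite in sign, in proportion \<open>c : d\<close>;
  this balances the two sectors. Every hypothesis is symmetric under exchanging \<open>K\<close> with \<open>L\<close>
  and \<open>\<zeta>\<close> with \<open>-\<zeta>\<close>, so each lemma also holds with the roles of the bodies exchanged.
\<close>

locale aligned_polar_pair =
  fixes K L :: "(real^3) set" and c d P Q t s \<zeta> :: real
  assumes conv: "convex K" "convex L" and comp: "compact K" "compact L"
    and sym: "d2d_symmetric K" "d2d_symmetric L"
    and pol: "polar_body K = L" "polar_body L = K"
    and pos: "0 < c" "0 < d" "0 < P" "0 < Q" "0 < t" "0 < s"
    and cd: "c * d = 1" and PQ: "P * Q = 1 + \<zeta>\<^sup>2" and ts: "2 * t * s = 1"
    and zeta: "\<bar>\<zeta>\<bar> \<le> 1"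
    and memK: "pt 0 0 c \<in> K" "pt 0 P (c * \<zeta>) \<in> K" "pt t t 0 \<in> K"
    and memL: "pt 0 0 d \<in> L" "pt 0 Q (- (d * \<zeta>)) \<in> L" "pt s s 0 \<in> L"
begin

lemma dual: "aligned_polar_pair L K d c Q P s t (- \<zeta>)"
proof -
  have "d * c = 1" "Q * P = 1 + (- \<zeta>)\<^sup>2" "2 * s * t = 1"
    using cd PQ ts by (simp_all add: algebra_simps)
  then show ?thesis
    using conv comp sym pol pos zeta memK memL by unfold_locales auto
qed

lemma pairing: "pt x y z \<in> K \<Longrightarrow> pt x' y' z' \<in> L \<Longrightarrow> x * x' + y * y' + z * z' \<le> 1"
  using polar_body_inner[of "pt x' y' z'" K "pt x y z"] pol by (simp add: inner_vec3 mult.commute)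

lemma memK_axis: "\<epsilon> \<in> {1, - 1} \<Longrightarrow> pt 0 0 (\<epsilon> * c) \<in> K"
  using memK(1) d2d_symmetricD(3)[OF sym(1) memK(1)] by auto

lemma zeroK: "0 \<in> K"
  using convex_midpoint[OF conv(1) memK_axis[of 1] memK_axis[of "- 1"]] by (simp add: pt_ops)

abbreviation "V \<epsilon> \<equiv> measure lebesgue (K \<inter> sector c P \<zeta> \<epsilon>)"

lemma piece: "compact (K \<inter> sector c P \<zeta> \<epsilon>)" "convex (K \<inter> sector c P \<zeta> \<epsilon>)"
  using comp conv closed_sector convex_sector
  by (auto intro: compact_Int_closed convex_Int)

lemma piece_vertices:
  assumes "\<epsilon> \<in> {1, - 1}"
  shows "{0, pt t t 0, pt 0 P (c * \<zeta>), pt 0 0 (\<epsilon> * c)} \<subseteq> K \<inter> sector c P \<zeta> \<epsilon>"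
  using assms zeroK memK memK_axis[OF assms] pos by (auto simp: sector_def algebra_simps)

text \<open>
  The fan of the two tetrahedra spanned by the edge from the origin to \<open>(t, t, 0)\<close> together with
  the consecutive points \<open>p = (0, P, c * \<zeta>)\<close>, \<open>X = (0, u, z)\<close>, \<open>(0, 0, \<epsilon> * c)\<close>. The plane through
  that edge and \<open>X\<close> has normal \<open>a\<close> and separates them, so their volumes add up inside the sector,
  and if they exhaust its volume they exhaust the sector as a set.
\<close>

lemma fan_in_sector:
  assumes e: "\<epsilon> \<in> {1, - 1}" and X: "pt 0 u z \<in> K" and u: "0 \<le> u"
    and k: "0 \<le> \<epsilon> * (P * z - c * \<zeta> * u)" and nz: "u \<noteq> 0 \<or> z \<noteq> 0"
  defines "a \<equiv> \<epsilon> *\<^sub>R pt z (- z) u"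
  shows "measure lebesgue (K \<inter> sector c P \<zeta> \<epsilon> \<inter> {x. a \<bullet> x \<le> 0}) \<ge> t / 6 * (\<epsilon> * (P * z - c * \<zeta> * u))" (is ?A)
    and "measure lebesgue (K \<inter> sector c P \<zeta> \<epsilon> \<inter> {x. 0 \<le> a \<bullet> x}) \<ge> t / 6 * (c * u)" (is ?B)
    and "V \<epsilon> = measure lebesgue (K \<inter> sector c P \<zeta> \<epsilon> \<inter> {x. 0 \<le> a \<bullet> x}) +
       measure lebesgue (K \<inter> sector c P \<zeta> \<epsilon> \<inter> {x. a \<bullet> x \<le> 0})" (is ?C)
    and "V \<epsilon> = t / 6 * (c * (1 - \<epsilon> * \<zeta>) * u + \<epsilon> * P * z) \<Longrightarrow> 0 < u \<Longrightarrow>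
       0 < \<epsilon> * (P * z - c * \<zeta> * u) \<Longrightarrow>
       K \<inter> sector c P \<zeta> \<epsilon> \<subseteq> convex hull {0, pt t t 0, pt 0 P (c * \<zeta>), pt 0 u z} \<union>
         convex hull {0, pt t t 0, pt 0 u z, pt 0 0 (\<epsilon> * c)}" (is "_ \<Longrightarrow> _ \<Longrightarrow> _ \<Longrightarrow> ?D")
proof -
  define S where "S = K \<inter> sector c P \<zeta> \<epsilon>"
  define T1 where "T1 = convex hull {0, pt t t 0, pt 0 P (c * \<zeta>), pt 0 u z}"
  define T2 where "T2 = convex hull {0, pt t t 0, pt 0 u z, pt 0 0 (\<epsilon> * c)}"
  have S: "compact S" "convex S" unfolding S_def by (rule piece)+
  have a: "a \<noteq> 0" using e nz by (auto simp: a_def vec_eq_iff forall_3)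
  have e2: "\<epsilon> * \<epsilon> = 1" using e by auto
  have XS: "pt 0 u z \<in> S" using X u k by (simp add: S_def sector_def)
  note vS = piece_vertices[OF e, folded S_def]
  have c1: "compact (S \<inter> {x. a \<bullet> x \<le> 0})" "convex (S \<inter> {x. a \<bullet> x \<le> 0})"
    and c2: "compact (S \<inter> {x. 0 \<le> a \<bullet> x})" "convex (S \<inter> {x. 0 \<le> a \<bullet> x})"
    using S by (auto intro!: compact_Int_closed convex_Int closed_halfspace_le closed_halfspace_ge
        convex_halfspace_le convex_halfspace_ge)
  have s1: "T1 \<subseteq> S \<inter> {x. a \<bullet> x \<le> 0}" unfolding T1_def
    by (rule hull_minimal[where S = convex, OF _ c1(2)])
      (use vS XS k in \<open>auto simp: a_def inner_vec3 algebra_simps\<close>)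
  have "0 \<le> u * c" using u pos by simp
  then have s2: "T2 \<subseteq> S \<inter> {x. 0 \<le> a \<bullet> x}" unfolding T2_def
    by (intro hull_minimal[where S = convex, OF _ c2(2)])
      (use vS XS e in \<open>auto simp: a_def inner_vec3 algebra_simps\<close>)
  have m1: "measure lebesgue T1 = t / 6 * (\<epsilon> * (P * z - c * \<zeta> * u))"
  proof -
    have "\<bar>P * z - c * \<zeta> * u\<bar> = \<epsilon> * (P * z - c * \<zeta> * u)" using e k by auto
    then show ?thesis unfolding T1_def measure_tetrahedron using pos
      by (simp add: triple_product_def abs_mult flip: right_diff_distrib)
  qed
  have m2: "measure lebesgue T2 = t / 6 * (c * u)"
    unfolding T2_def measure_tetrahedron using pos u e by (auto simp: triple_product_def abs_mult)
  have T: "compact T1" "compact T2"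
    unfolding T1_def T2_def by (simp_all add: finite_imp_compact_convex_hull)
  have le: "measure lebesgue T1 \<le> measure lebesgue (S \<inter> {x. a \<bullet> x \<le> 0})"
    "measure lebesgue T2 \<le> measure lebesgue (S \<inter> {x. 0 \<le> a \<bullet> x})"
    using s1 s2 T c1 c2 by (auto intro!: measure_mono_fmeasurable lmeasurable_compact fmeasurableD)
  show A: ?A using le(1) m1 by (simp add: S_def)
  show B: ?B using le(2) m2 by (simp add: S_def)
  have split: "measure lebesgue S = measure lebesgue (S \<inter> {x. 0 \<le> a \<bullet> x}) +
      measure lebesgue (S \<inter> {x. a \<bullet> x \<le> 0})"
    by (rule measure_halfspace_split[OF lmeasurable_compact[OF S(1)] a])
  then show ?C by (simp add: S_def)
  assume V: "V \<epsilon> = t / 6 * (c * (1 - \<epsilon> * \<zeta>) * u + \<epsilon> * P * z)" and u0: "0 < u"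
    and k0: "0 < \<epsilon> * (P * z - c * \<zeta> * u)"
  have "V \<epsilon> = measure lebesgue T1 + measure lebesgue T2"
    unfolding V m1 m2 by (simp add: field_simps)
  then have eq: "measure lebesgue T1 = measure lebesgue (S \<inter> {x. a \<bullet> x \<le> 0})"
    "measure lebesgue T2 = measure lebesgue (S \<inter> {x. 0 \<le> a \<bullet> x})"
    using le split by (simp_all add: S_def)
  have "0 < measure lebesgue T1" "0 < measure lebesgue T2"
    unfolding m1 m2 using pos u0 k0 by auto
  then have "T1 = S \<inter> {x. a \<bullet> x \<le> 0}" "T2 = S \<inter> {x. 0 \<le> a \<bullet> x}"
    using compact_convex_full_subset_eq[OF T(1) c1 s1 eq(1)]
      compact_convex_full_subset_eq[OF T(2) c2 s2 eq(2)] eq by auto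
  then show ?D unfolding S_def[symmetric] T1_def[symmetric] T2_def[symmetric] by auto
qed

text \<open>
  The left side is linear in \<open>X = (0, u, z)\<close>: it is the signed volume of the fan through \<open>X\<close>. If \<open>X\<close>
  lies in the sector, the fan fits into it. If \<open>X\<close> lies beyond \<open>p\<close>, the signed volume is at most
  that of the single tetrahedron through \<open>p\<close>, because \<open>X\<close> satisfies the inequality given by
  the point of \<open>L\<close> paired with \<open>p\<close>.
\<close>

lemma support_le_volume:
  assumes e: "\<epsilon> \<in> {1, - 1}" and X: "pt 0 u z \<in> K" and u: "0 \<le> u"
  shows "t / 6 * (c * (1 - \<epsilon> * \<zeta>) * u + \<epsilon> * P * z) \<le> V \<epsilon>"
proof -
  have fan_in_sector': "t / 6 * (c * (1 - \<epsilon> * \<zeta>) * u + \<epsilon> * P * z) \<le> V \<epsilon>"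
    if "pt 0 u z \<in> K" "0 \<le> u" "0 \<le> \<epsilon> * (P * z - c * \<zeta> * u)" for u z
  proof (cases "u \<noteq> 0 \<or> z \<noteq> 0")
    case True
    show ?thesis
      using fan_in_sector(1-3)[OF e that True] by (simp add: algebra_simps)
  qed auto
  show ?thesis
  proof (cases "0 \<le> \<epsilon> * (P * z - c * \<zeta> * u)")
    case True
    then show ?thesis using fan_in_sector'[OF X u] by simp
  next
    case False
    \<comment> \<open>The amount \<open>\<delta>\<close> by which \<open>X\<close> lies beyond \<open>p\<close>: the pairing with \<open>(0, Q, -d * \<zeta>)\<close> gives
      \<open>u + \<epsilon> * \<zeta> * \<delta> \<le> P\<close>, hence \<open>u - \<delta> \<le> P\<close> since \<open>\<bar>\<zeta>\<bar> \<le> 1\<close>.\<close>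
    define y where "y = \<epsilon> * d * z"
    define \<delta> where "\<delta> = \<epsilon> * \<zeta> * u - P * y"
    have e2: "\<epsilon> * \<epsilon> = 1" using e by auto
    have z: "\<epsilon> * z = c * y" using cd by (simp add: y_def algebra_simps)
    have "\<epsilon> * (P * z - c * \<zeta> * u) = - c * \<delta>"
      unfolding \<delta>_def using z by (simp add: algebra_simps)
    then have "0 < c * \<delta>" using False by simp
    then have \<delta>: "0 < \<delta>" by (rule zero_less_mult_pos[OF _ pos(1)])
    have "u * Q - z * (d * \<zeta>) \<le> 1" using pairing[OF X memL(2)] by simp
    moreover have "z * (d * \<zeta>) = y * (\<epsilon> * \<zeta>)"
      using e unfolding y_def by auto
    ultimately have "u * Q - y * (\<epsilon> * \<zeta>) \<le> 1" by linarith
    then have "P * (u * Q - y * (\<epsilon> * \<zeta>)) \<le> P * 1"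
      using pos(3) by (rule mult_left_mono[OF _ less_imp_le])
    moreover have "P * (u * Q - y * (\<epsilon> * \<zeta>)) = u + \<epsilon> * \<zeta> * \<delta>"
    proof -
      have "P * (u * Q - y * (\<epsilon> * \<zeta>)) = u * (P * Q) - P * y * \<epsilon> * \<zeta>" by (simp add: algebra_simps)
      also have "\<dots> = u + \<epsilon> * \<epsilon> * \<zeta>\<^sup>2 * u - P * y * \<epsilon> * \<zeta>" unfolding PQ e2 by (simp add: algebra_simps)
      also have "\<dots> = u + \<epsilon> * \<zeta> * \<delta>" unfolding \<delta>_def by (simp add: algebra_simps power2_eq_square)
      finally show ?thesis .
    qed
    moreover have "- \<delta> \<le> \<epsilon> * \<zeta> * \<delta>"
    proof -
      have "- 1 \<le> \<epsilon> * \<zeta>" using e zeta by auto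
      then have "- 1 * \<delta> \<le> \<epsilon> * \<zeta> * \<delta>" using \<delta> by (intro mult_right_mono) auto
      then show ?thesis by simp
    qed
    ultimately have "u - \<delta> \<le> P" by simp
    then have "c * (u - \<delta>) \<le> c * P" using pos by simp
    moreover have "c * (u - \<delta>) = c * (1 - \<epsilon> * \<zeta>) * u + \<epsilon> * P * z"
      unfolding \<delta>_def using z by (simp add: algebra_simps)
    ultimately have "t / 6 * (c * (1 - \<epsilon> * \<zeta>) * u + \<epsilon> * P * z) \<le> t / 6 * (c * P)"
      using pos by (intro mult_left_mono) auto
    also have "\<dots> = t / 6 * (c * (1 - \<epsilon> * \<zeta>) * P + \<epsilon> * P * (c * \<zeta>))" by (simp add: algebra_simps)
    also have "\<dots> \<le> V \<epsilon>"
      using fan_in_sector'[OF memK(2)] pos by simp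
    finally show ?thesis .
  qed
qed

lemma V_pos: "\<epsilon> \<in> {1, - 1} \<Longrightarrow> 0 < V \<epsilon>"
proof -
  assume e: "\<epsilon> \<in> {1, - 1}"
  have "0 < t / 6 * (c * P)" using pos by simp
  also have "\<dots> = t / 6 * (c * (1 - \<epsilon> * \<zeta>) * P + \<epsilon> * P * (c * \<zeta>))" by (simp add: algebra_simps)
  also have "\<dots> \<le> V \<epsilon>" using support_le_volume[OF e memK(2)] pos by simp
  finally show ?thesis .
qed

text \<open>
  Dividing the linear bound of the previous lemma by the sector volume gives a functional that
  is at most one on \<open>K\<close>, that is, a point of \<open>L\<close>.
\<close>

definition dual_point where
  "dual_point \<epsilon> = (t / (6 * V \<epsilon>)) *\<^sub>R pt 0 (c * (1 - \<epsilon> * \<zeta>)) (\<epsilon> * P)"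

lemma dual_point_mem:
  assumes e: "\<epsilon> \<in> {1, - 1}"
  shows "dual_point \<epsilon> \<in> L"
  unfolding pol(1)[symmetric] polar_body_def
proof (intro CollectI ballI)
  fix X assume "X \<in> K"
  then have "pt (X $ 1) (X $ 2) (X $ 3) \<in> K" by (simp add: pt_eta)
  then have "pt 0 \<bar>X $ 2\<bar> (X $ 3) \<in> K" by (rule d2d_symmetric_averages[OF conv(1) sym(1)])
  then have le: "t / 6 * (c * (1 - \<epsilon> * \<zeta>) * \<bar>X $ 2\<bar> + \<epsilon> * P * X $ 3) \<le> V \<epsilon>"
    by (rule support_le_volume[OF e]) simp
  \<comment> \<open>The functional has a nonnegative second coefficient, so the bound at the reflected point
    \<open>(0, \<bar>y\<bar>, z)\<close> dominates its value at the given point.\<close>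
  have "0 \<le> 1 - \<epsilon> * \<zeta>" using e zeta by auto
  then have "c * (1 - \<epsilon> * \<zeta>) * X $ 2 \<le> c * (1 - \<epsilon> * \<zeta>) * \<bar>X $ 2\<bar>"
    using pos by (intro mult_left_mono) auto
  then have "t / 6 * (c * (1 - \<epsilon> * \<zeta>) * X $ 2 + \<epsilon> * P * X $ 3)
      \<le> t / 6 * (c * (1 - \<epsilon> * \<zeta>) * \<bar>X $ 2\<bar> + \<epsilon> * P * X $ 3)"
    using pos by (intro mult_left_mono) auto
  with le have "t / 6 * (c * (1 - \<epsilon> * \<zeta>) * X $ 2 + \<epsilon> * P * X $ 3) / V \<epsilon> \<le> 1"
    using V_pos[OF e] by simp
  then show "dual_point \<epsilon> \<bullet> X \<le> 1"
    using V_pos[OF e] by (simp add: dual_point_def inner_vec3 field_simps)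
qed

abbreviation "W \<epsilon> \<equiv> measure lebesgue (L \<inter> sector d Q (- \<zeta>) \<epsilon>)"

text \<open>
  The signed fan volume of \<open>L\<close> at the dual point depends on \<open>V \<epsilon>\<close> alone: the parameters
  combine to \<open>(1 - \<zeta>\<^sup>2) * c * d + P * Q = 2\<close> and \<open>2 * t * s = 1\<close>.
\<close>

lemma support_at_dual_point:
  assumes e: "\<epsilon> \<in> {1, - 1}"
  shows "s / 6 * (d * (1 - \<epsilon> * - \<zeta>) * dual_point \<epsilon> $ 2 + \<epsilon> * Q * dual_point \<epsilon> $ 3) = 1 / (36 * V \<epsilon>)"
proof -
  have e2: "\<epsilon> * \<epsilon> = 1" using e by auto
  have "d * (1 - \<epsilon> * - \<zeta>) * (c * (1 - \<epsilon> * \<zeta>)) + \<epsilon> * Q * (\<epsilon> * P) =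
      c * d * (1 - \<epsilon> * \<epsilon> * \<zeta>\<^sup>2) + (\<epsilon> * \<epsilon>) * (P * Q)"
    by (simp add: algebra_simps power2_eq_square)
  also have "\<dots> = 2" unfolding e2 cd PQ by simp
  finally have two: "d * (1 - \<epsilon> * - \<zeta>) * (c * (1 - \<epsilon> * \<zeta>)) + \<epsilon> * Q * (\<epsilon> * P) = 2" .
  define k where "k = t / (6 * V \<epsilon>)"
  have "s / 6 * (d * (1 - \<epsilon> * - \<zeta>) * dual_point \<epsilon> $ 2 + \<epsilon> * Q * dual_point \<epsilon> $ 3) =
      s / 6 * k * (d * (1 - \<epsilon> * - \<zeta>) * (c * (1 - \<epsilon> * \<zeta>)) + \<epsilon> * Q * (\<epsilon> * P))"
    unfolding dual_point_def k_def[symmetric] by (simp add: algebra_simps)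
  also have "\<dots> = (2 * t * s) / (36 * V \<epsilon>)" unfolding two k_def by simp
  finally show ?thesis unfolding ts .
qed

lemma dual_point_eta: "dual_point \<epsilon> = pt 0 (dual_point \<epsilon> $ 2) (dual_point \<epsilon> $ 3)"
  by (simp add: dual_point_def vec_eq_iff forall_3)

lemma dual_point_nonneg: "\<epsilon> \<in> {1, - 1} \<Longrightarrow> 0 \<le> dual_point \<epsilon> $ 2"
  using zeta pos V_pos[of \<epsilon>] by (auto simp: dual_point_def intro!: mult_nonneg_nonneg)

text \<open>
  Apply the volume bound twice: in \<open>K\<close> it produces the dual point of \<open>L\<close>, and in \<open>L\<close> it is
  evaluated at that point.
\<close>

lemma sector_product:
  assumes e: "\<epsilon> \<in> {1, - 1}"
  shows "1 / 36 \<le> V \<epsilon> * W \<epsilon>"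
proof -
  have "1 / (36 * V \<epsilon>) \<le> W \<epsilon>"
    using aligned_polar_pair.support_le_volume[OF dual e, of "dual_point \<epsilon> $ 2" "dual_point \<epsilon> $ 3"]
      dual_point_mem[OF e] dual_point_nonneg[OF e] support_at_dual_point[OF e]
    by (simp flip: dual_point_eta)
  then show ?thesis using V_pos[OF e] by (simp add: field_simps)
qed

lemma volume_eq_sum: "measure lebesgue K = 8 * (V 1 + V (- 1))"
proof -
  define S where "S = K \<inter> {X. 0 \<le> X $ 1 \<and> X $ 1 \<le> X $ 2}"
  define a where "a = pt (c * \<zeta>) (- (c * \<zeta>)) P"
  have S: "S = K \<inter> ({X. 0 \<le> pt 1 0 0 \<bullet> X} \<inter> {X. 0 \<le> pt (- 1) 1 0 \<bullet> X})"
    by (auto simp: S_def inner_vec3)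
  have cS: "compact S" unfolding S
    by (intro compact_Int_closed comp closed_Int closed_halfspace_inner)
  have "a \<noteq> 0" using pos by (simp add: a_def vec_eq_iff forall_3)
  then have "measure lebesgue S = measure lebesgue (S \<inter> {x. 0 \<le> a \<bullet> x}) + measure lebesgue (S \<inter> {x. a \<bullet> x \<le> 0})"
    by (rule measure_halfspace_split[OF lmeasurable_compact[OF cS]])
  also have "S \<inter> {x. 0 \<le> a \<bullet> x} = K \<inter> sector c P \<zeta> 1"
    by (auto simp: S_def sector_def a_def inner_vec3 algebra_simps)
  also have "S \<inter> {x. a \<bullet> x \<le> 0} = K \<inter> sector c P \<zeta> (- 1)"
    by (auto simp: S_def sector_def a_def inner_vec3 algebra_simps)
  finally show ?thesis
    using d2d_symmetric_measure_wedge[OF comp(1) sym(1)] by (simp add: S_def)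
qed

end

text \<open>
  Cauchy--Schwarz for two summands, with its equality case: the cross terms \<open>a * b'\<close> and \<open>b * a'\<close>
  have product at least \<open>m\<^sup>2\<close>, hence sum at least \<open>2 * m\<close>.
\<close>

lemma product_of_sums:
  fixes a b a' b' m :: real
  assumes "0 < m" "0 < a" "0 < b" "0 < a'" "0 < b'" "m \<le> a * a'" "m \<le> b * b'"
  shows "4 * m \<le> (a + b) * (a' + b')"
    and "(a + b) * (a' + b') = 4 * m \<Longrightarrow> a = b \<and> a' = b' \<and> a * a' = m"
proof -
  have "m\<^sup>2 \<le> (a * a') * (b * b')"
    unfolding power2_eq_square using assms by (intro mult_mono) auto
  also have "4 * \<dots> = (a * b' + b * a')\<^sup>2 - (a * b' - b * a')\<^sup>2"
    by (simp add: power2_eq_square algebra_simps)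
  finally have sq: "(2 * m)\<^sup>2 + (a * b' - b * a')\<^sup>2 \<le> (a * b' + b * a')\<^sup>2"
    by (simp add: power_mult_distrib)
  then have "(2 * m)\<^sup>2 \<le> (a * b' + b * a')\<^sup>2"
    by (smt (verit) zero_le_power2)
  then have cross: "2 * m \<le> a * b' + b * a'"
    by (rule power2_le_imp_le) (use assms in auto)
  then show "4 * m \<le> (a + b) * (a' + b')"
    using assms by (simp add: algebra_simps)
  assume "(a + b) * (a' + b') = 4 * m"
  then have "a * a' + b * b' + (a * b' + b * a') = 4 * m" by (simp add: algebra_simps)
  then have eq: "a * a' = m" "b * b' = m" "a * b' + b * a' = 2 * m"
    using cross assms by linarith+
  then have "(a * b' - b * a')\<^sup>2 \<le> 0" using sq by simp
  then have "a * b' = b * a'" by simp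
  then have "a * b' = a * a'" "a * b' = b * b'" using eq by auto
  then show "a = b \<and> a' = b' \<and> a * a' = m" using assms eq by auto
qed

section \<open>The case of equality\<close>

lemma small_enough:
  fixes a b a' b' a'' b'' :: real
  assumes "0 < a" "0 < b" "0 < a'" "0 < b'" "0 < a''" "0 < b''"
  obtains u where "0 < u" "u * a \<le> b" "u * a' \<le> b'" "u * a'' \<le> b''"
proof -
  define u where "u = min (b / a) (min (b' / a') (b'' / a''))"
  have "u \<le> b / a" "u \<le> b' / a'" "u \<le> b'' / a''" by (auto simp: u_def)
  then have "u * a \<le> b" "u * a' \<le> b'" "u * a'' \<le> b''"
    using assms by (simp_all add: pos_le_divide_eq)
  moreover have "0 < u" using assms by (simp add: u_def)
  ultimately show ?thesis by (rule that[rotated])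
qed

text \<open>
  Only the vertex \<open>(s, s, 0)\<close> has a positive first coordinate, so a point with \<open>x > 0\<close> gives it a
  positive weight, and this vertex has height zero.
\<close>

lemma tetrahedron_height:
  assumes q: "q \<in> convex hull {0, pt s s 0, A, B}" and s: "0 < s" and d: "0 < d"
    and A: "A $ 1 = 0" "\<bar>A $ 3\<bar> \<le> d" and B: "B $ 1 = 0" "\<bar>B $ 3\<bar> \<le> d" and q1: "0 < q $ 1"
  shows "\<bar>q $ 3\<bar> < d"
proof -
  obtain r a b where r: "0 \<le> r" "0 \<le> a" "0 \<le> b" "r + a + b \<le> 1"
    "q = r *\<^sub>R pt s s 0 + a *\<^sub>R A + b *\<^sub>R B"
    using tetrahedron_points[OF q] by metis
  have "0 < r" using q1 r s A B by (auto simp: zero_less_mult_iff)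
  have "\<bar>q $ 3\<bar> \<le> \<bar>a * A $ 3\<bar> + \<bar>b * B $ 3\<bar>" using r by simp
  also have "\<dots> \<le> a * d + b * d"
    using r A B by (intro add_mono) (auto simp: abs_mult intro!: mult_left_mono)
  also have "\<dots> = (a + b) * d" by (simp add: algebra_simps)
  also have "\<dots> < 1 * d" using \<open>0 < r\<close> r d by (intro mult_strict_right_mono) auto
  finally show ?thesis by simp
qed

text \<open>
  The tetrahedron whose upper edge is parallel to the second axis and whose lower edge is
  parallel to the first. It is a linear image of the regular one.
\<close>

definition std_tetrahedron :: "(real^3) set" where
  "std_tetrahedron = convex hull {pt 0 1 1, pt 0 (- 1) 1, pt 1 0 (- 1), pt (- 1) 0 (- 1)}"

lemma convex_combination_4:
  fixes A :: "'a::real_vector"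
  assumes "convex C" "A \<in> C" "B \<in> C" "A' \<in> C" "B' \<in> C" "0 \<le> a" "0 \<le> b" "0 \<le> a'" "0 \<le> b'"
    "a + b + a' + b' = (1 :: real)"
  shows "a *\<^sub>R A + b *\<^sub>R B + a' *\<^sub>R A' + b' *\<^sub>R B' \<in> C"
proof -
  have "(\<Sum>i\<in>{0, 1, 2, 3::nat}. ([a, b, a', b'] ! i) *\<^sub>R ([A, B, A', B'] ! i)) \<in> C"
    using assms by (intro convex_sum) (auto simp: add.assoc)
  then show ?thesis by (simp add: add.assoc)
qed

lemma std_tetrahedron_iff:
  "X \<in> std_tetrahedron \<longleftrightarrow> \<bar>X $ 2\<bar> \<le> (1 + X $ 3) / 2 \<and> \<bar>X $ 1\<bar> \<le> (1 - X $ 3) / 2"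
proof
  let ?H = "{X. pt 0 2 (- 1) \<bullet> X \<le> 1} \<inter> {X. pt 0 (- 2) (- 1) \<bullet> X \<le> 1} \<inter>
    {X. pt 2 0 1 \<bullet> X \<le> 1} \<inter> {X. pt (- 2) 0 1 \<bullet> X \<le> 1}"
  have "convex ?H" by (intro convex_Int convex_halfspace_le)
  then have "std_tetrahedron \<subseteq> ?H"
    unfolding std_tetrahedron_def by (rule hull_minimal[rotated]) (auto simp: inner_vec3)
  then show "X \<in> std_tetrahedron \<Longrightarrow> \<bar>X $ 2\<bar> \<le> (1 + X $ 3) / 2 \<and> \<bar>X $ 1\<bar> \<le> (1 - X $ 3) / 2"
    by (auto simp: inner_vec3 abs_le_iff dest!: subsetD)
next
  assume X: "\<bar>X $ 2\<bar> \<le> (1 + X $ 3) / 2 \<and> \<bar>X $ 1\<bar> \<le> (1 - X $ 3) / 2"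
  define h where "h = X $ 3"
  define x where "x = X $ 1 / 2"
  define y where "y = X $ 2 / 2"
  have "((1 + h) / 4 + y) *\<^sub>R pt 0 1 1 + ((1 + h) / 4 - y) *\<^sub>R pt 0 (- 1) 1 +
      ((1 - h) / 4 + x) *\<^sub>R pt 1 0 (- 1) + ((1 - h) / 4 - x) *\<^sub>R pt (- 1) 0 (- 1) \<in> std_tetrahedron"
    using X unfolding std_tetrahedron_def
    by (intro convex_combination_4 convex_convex_hull hull_inc)
      (auto simp: h_def x_def y_def abs_le_iff field_simps)
  also have "((1 + h) / 4 + y) *\<^sub>R pt 0 1 1 + ((1 + h) / 4 - y) *\<^sub>R pt 0 (- 1) 1 +
      ((1 - h) / 4 + x) *\<^sub>R pt 1 0 (- 1) + ((1 - h) / 4 - x) *\<^sub>R pt (- 1) 0 (- 1) = X"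
    by (simp add: vec_eq_iff forall_3 h_def x_def y_def field_simps)
  finally show "X \<in> std_tetrahedron" .
qed

context aligned_polar_pair
begin

lemma W_pos: "\<epsilon> \<in> {1, - 1} \<Longrightarrow> 0 < W \<epsilon>"
  by (rule aligned_polar_pair.V_pos[OF dual])

text \<open>
  The two sectors contribute \<open>64 * (V 1 + V (-1)) * (W 1 + W (-1))\<close>, and \<open>64 * 4 / 36 = 64 / 9\<close>.
\<close>

lemma volume_product_ge: "64 / 9 \<le> measure lebesgue K * measure lebesgue L"
  and volume_product_eqD: "measure lebesgue K * measure lebesgue L = 64 / 9 \<Longrightarrow>
    V 1 = V (- 1) \<and> W 1 = W (- 1) \<and> V 1 * W 1 = 1 / 36"
proof -
  have prod: "measure lebesgue K * measure lebesgue L = 64 * ((V 1 + V (- 1)) * (W 1 + W (- 1)))"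
    unfolding volume_eq_sum aligned_polar_pair.volume_eq_sum[OF dual] by (simp add: algebra_simps)
  note * = product_of_sums[of "1 / 36" "V 1" "V (- 1)" "W 1" "W (- 1)"]
  show "64 / 9 \<le> measure lebesgue K * measure lebesgue L"
    using *(1) V_pos W_pos sector_product unfolding prod by simp
  assume "measure lebesgue K * measure lebesgue L = 64 / 9"
  then show "V 1 = V (- 1) \<and> W 1 = W (- 1) \<and> V 1 * W 1 = 1 / 36"
    using *(2) V_pos W_pos sector_product unfolding prod by simp
qed

lemma sector_cover:
  assumes "0 \<le> X $ 1" "X $ 1 \<le> X $ 2"
  obtains \<epsilon> where "\<epsilon> \<in> {1, - 1}" "X \<in> sector c P \<zeta> \<epsilon>"
proof (cases "0 \<le> P * X $ 3 - c * \<zeta> * (X $ 2 - X $ 1)")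
  case True
  then show ?thesis using assms by (intro that[of 1]) (auto simp: sector_def)
next
  case False
  then show ?thesis using assms by (intro that[of "- 1"]) (auto simp: sector_def)
qed

lemma height_le:
  assumes "X \<in> K" shows "\<bar>X $ 3\<bar> \<le> c"
proof -
  have X: "pt (X $ 1) (X $ 2) (X $ 3) \<in> K" using assms by (simp add: pt_eta)
  have "X $ 3 * d \<le> 1" "X $ 3 * - d \<le> 1"
    using pairing[OF X aligned_polar_pair.memK_axis[OF dual, of 1]]
      pairing[OF X aligned_polar_pair.memK_axis[OF dual, of "- 1"]] by simp_all
  then have "X $ 3 * d \<le> c * d" "- (X $ 3) * d \<le> c * d" using cd by simp_all
  then show ?thesis
    unfolding mult_le_cancel_right_pos[OF pos(2)] by (simp add: abs_le_iff)
qed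

text \<open>
  Equality in the product bound of a sector means that the fan of \<open>L\<close> through the dual point has
  the full volume of the sector. For \<open>\<bar>\<zeta>\<bar> < 1\<close> both of its tetrahedra are nondegenerate, so the
  sector of \<open>L\<close> is this fan.
\<close>

lemma sector_is_fan_of_equality:
  assumes e: "\<epsilon> \<in> {1, - 1}" and z: "\<bar>\<zeta>\<bar> < 1"
    and eq: "measure lebesgue K * measure lebesgue L = 64 / 9"
  shows "L \<inter> sector d Q (- \<zeta>) \<epsilon> \<subseteq>
    convex hull {0, pt s s 0, pt 0 Q (- (d * \<zeta>)), dual_point \<epsilon>} \<union>
    convex hull {0, pt s s 0, dual_point \<epsilon>, pt 0 0 (\<epsilon> * d)}"
proof -
  define k where "k = t / (6 * V \<epsilon>)"
  have k: "0 < k" using pos V_pos[OF e] by (simp add: k_def)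
  have dp: "dual_point \<epsilon> $ 2 = k * (c * (1 - \<epsilon> * \<zeta>))" "dual_point \<epsilon> $ 3 = k * (\<epsilon> * P)"
    by (simp_all add: dual_point_def k_def)
  have e2: "\<epsilon> * \<epsilon> = 1" using e by auto
  have ez: "0 < 1 - \<epsilon> * \<zeta>" "0 < 1 + \<epsilon> * \<zeta>" using e z by auto
  have "V \<epsilon> * W \<epsilon> = 1 / 36" using volume_product_eqD[OF eq] e by auto
  then have "1 / (36 * V \<epsilon>) = W \<epsilon>" using V_pos[OF e] by (simp add: field_simps)
  then have W: "W \<epsilon> = s / 6 * (d * (1 - \<epsilon> * - \<zeta>) * dual_point \<epsilon> $ 2 + \<epsilon> * Q * dual_point \<epsilon> $ 3)"
    using support_at_dual_point[OF e] by simp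
  have u: "0 < dual_point \<epsilon> $ 2" unfolding dp using k pos ez by simp
  have "\<epsilon> * (Q * dual_point \<epsilon> $ 3 - d * - \<zeta> * dual_point \<epsilon> $ 2) =
      k * ((\<epsilon> * \<epsilon>) * (P * Q) + (c * d) * (\<epsilon> * \<zeta> - (\<epsilon> * \<epsilon>) * \<zeta>\<^sup>2))"
    unfolding dp by (simp add: algebra_simps power2_eq_square)
  also have "\<dots> = k * (1 + \<epsilon> * \<zeta>)" unfolding e2 cd PQ by simp
  also have "\<dots> > 0" using k ez by simp
  finally have kap: "0 < \<epsilon> * (Q * dual_point \<epsilon> $ 3 - d * - \<zeta> * dual_point \<epsilon> $ 2)" .
  have "pt 0 (dual_point \<epsilon> $ 2) (dual_point \<epsilon> $ 3) \<in> L"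
    using dual_point_mem[OF e] dual_point_eta[of \<epsilon>] by simp
  from aligned_polar_pair.fan_in_sector(4)[OF dual e this less_imp_le[OF u] less_imp_le[OF kap] _ W u kap] u
  show ?thesis by (simp flip: dual_point_eta)
qed

lemma dual_strict_height:
  assumes z: "\<bar>\<zeta>\<bar> < 1" and eq: "measure lebesgue K * measure lebesgue L = 64 / 9"
    and X: "X \<in> L" "0 < X $ 1" "X $ 1 \<le> X $ 2"
  shows "\<bar>X $ 3\<bar> < d"
proof -
  obtain \<epsilon> where e: "\<epsilon> \<in> {1, - 1}" "X \<in> sector d Q (- \<zeta>) \<epsilon>"
    using aligned_polar_pair.sector_cover[OF dual, of X] X by auto
  have h: "\<bar>Y $ 3\<bar> \<le> d" if "Y \<in> L" for Y
    by (rule aligned_polar_pair.height_le[OF dual that])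
  have ax: "pt 0 0 (\<epsilon> * d) \<in> L" by (rule aligned_polar_pair.memK_axis[OF dual e(1)])
  have d1: "dual_point \<epsilon> $ 1 = 0" by (simp add: dual_point_def)
  show ?thesis
    using sector_is_fan_of_equality[OF e(1) z eq] e X(1)
      tetrahedron_height[OF _ pos(6,2) _ h[OF memL(2)] d1 h[OF dual_point_mem[OF e(1)]] X(2)]
      tetrahedron_height[OF _ pos(6,2) d1 h[OF dual_point_mem[OF e(1)]] _ h[OF ax] X(2)]
    by auto
qed

text \<open>
  If both ends of the section \<open>x = 0\<close> of \<open>L\<close> were proper segments, then after the half-turn the
  body would contain points \<open>(0, u, d)\<close> and \<open>(v, 0, d)\<close> with \<open>u, v > 0\<close>. The segment between
  them meets the plane \<open>x = y\<close> at a point with \<open>x > 0\<close>, where the height is less than \<open>d\<close>.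
\<close>

lemma dual_no_flat_end:
  assumes z: "\<bar>\<zeta>\<bar> < 1" and eq: "measure lebesgue K * measure lebesgue L = 64 / 9"
  obtains \<epsilon> where "\<epsilon> \<in> {1, - 1}" "\<And>u. 0 < u \<Longrightarrow> pt 0 u (\<epsilon> * d) \<notin> L"
proof -
  have False if u: "0 < u" "pt 0 u (1 * d) \<in> L" and v: "0 < v" "pt 0 v (- 1 * d) \<in> L" for u v
  proof -
    have v': "pt v 0 d \<in> L" using d2d_symmetricD(3)[OF sym(2) v(2)] by simp
    have "(v / (u + v)) *\<^sub>R pt 0 u d + (u / (u + v)) *\<^sub>R pt v 0 d \<in> L"
      using u v v' by (intro convexD[OF conv(2)]) (auto simp flip: add_divide_distrib)
    also have "(v / (u + v)) *\<^sub>R pt 0 u d + (u / (u + v)) *\<^sub>R pt v 0 d =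
        pt (u * v / (u + v)) (u * v / (u + v)) d"
    proof -
      have "v / (u + v) + u / (u + v) = 1"
        using u v by (simp flip: add_divide_distrib)
      then have "v / (u + v) * d + u / (u + v) * d = d"
        by (simp only: distrib_right[symmetric] mult_1)
      then show ?thesis by (simp add: pt_ops pt_eq_iff mult.commute)
    qed
    finally have "\<bar>d\<bar> < d"
      using dual_strict_height[OF z eq, of "pt (u * v / (u + v)) (u * v / (u + v)) d"] u v by simp
    then show False by simp
  qed
  then show ?thesis using that by (metis insertCI)
qed

text \<open>
  If \<open>(0, u, \<epsilon> * c)\<close> lies outside \<open>K\<close> for every \<open>u > 0\<close>, then points of \<open>L\<close> exclude it for
  arbitrarily small \<open>u\<close>. As \<open>L\<close> is covered by reflected fans, vertices of these fans exclude it
  too, and such a vertex has height \<open>\<epsilon> * d\<close> and does not lie on the vertical axis. For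
  \<open>\<bar>\<zeta>\<bar> < 1\<close> only the dual point is possible, and its height has absolute value \<open>t * P / (6 * V 1)\<close>.
\<close>

lemma volume_of_pointed_end:
  assumes z: "\<bar>\<zeta>\<bar> < 1" and eq: "measure lebesgue K * measure lebesgue L = 64 / 9"
    and e: "\<epsilon> \<in> {1, - 1}" and pointed: "\<And>u. 0 < u \<Longrightarrow> pt 0 u (\<epsilon> * c) \<notin> K"
  shows "6 * V 1 = t * c * P"
proof (rule ccontr)
  assume ne: "6 * V 1 \<noteq> t * c * P"
  define k where "k = t / (6 * V 1)"
  have k: "0 < k" using pos V_pos[of 1] by (simp add: k_def)
  have VV: "V (- 1) = V 1" using volume_product_eqD[OF eq] by simp
  have dp: "dual_point \<delta> = pt 0 (k * (c * (1 - \<delta> * \<zeta>))) (k * (\<delta> * P))" if "\<delta> \<in> {1, - 1}" for \<delta>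
    using that VV by (auto simp: dual_point_def k_def pt_ops)
  have "k * P * c \<le> 1"
    using pairing[OF memK_axis[of 1] dual_point_mem[of 1, unfolded dp[of 1, simplified]]]
    by (simp add: mult_ac)
  moreover have "k * P * c \<noteq> 1"
    using ne V_pos[of 1] by (simp add: k_def field_simps)
  ultimately have kPc: "0 < 1 - k * P * c" by simp
  have ez: "0 < 1 + \<epsilon> * \<zeta>" using e z by auto
  \<comment> \<open>For small \<open>u\<close>, the point \<open>g = (0, u, \<epsilon> * c)\<close> still satisfies the constraints of all vertices
    of the fans of \<open>L\<close>; hence it lies in \<open>K\<close>.\<close>
  obtain u where u: "0 < u" "u * s \<le> 1" "u * Q \<le> 1 + \<epsilon> * \<zeta>" "u * (k * (c * 2)) \<le> 1 - k * P * c"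
    by (rule small_enough[of s 1 Q "1 + \<epsilon> * \<zeta>" "k * (c * 2)" "1 - k * P * c"])
      (use pos k kPc ez in auto)
  define g where "g = pt 0 u (\<epsilon> * c)"
  have dpg: "g \<bullet> dual_point \<delta> \<le> 1" if d: "\<delta> \<in> {1, - 1}" for \<delta>
  proof -
    have "u * (k * (c * (1 - \<delta> * \<zeta>))) \<le> u * (k * (c * 2))"
      using u k pos d z by (intro mult_left_mono) auto
    moreover have "(\<epsilon> * \<delta>) * (k * P * c) \<le> k * P * c"
      using e d k pos by auto
    ultimately show ?thesis
      using u(4) by (simp add: g_def dp[OF d] inner_vec3 algebra_simps)
  qed
  have "\<epsilon> * c * (d * \<zeta>) = (c * d) * (\<epsilon> * \<zeta>)" by simp
  then have "\<epsilon> * c * (d * \<zeta>) = \<epsilon> * \<zeta>" using cd by simp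
  moreover have "g \<bullet> pt 0 Q (- (d * \<zeta>)) = u * Q - \<epsilon> * c * (d * \<zeta>)"
    by (simp add: g_def inner_vec3)
  ultimately have pg: "g \<bullet> pt 0 Q (- (d * \<zeta>)) \<le> 1" using u(3) by linarith
  have sg: "g \<bullet> pt s s 0 \<le> 1" using u(2) by (simp add: g_def inner_vec3)
  have eg: "g \<bullet> pt 0 0 (\<delta> * d) \<le> 1" if d: "\<delta> \<in> {1, - 1}" for \<delta>
  proof -
    have "\<epsilon> * c * (\<delta> * d) = (c * d) * (\<epsilon> * \<delta>)" by simp
    also have "\<dots> = \<epsilon> * \<delta>" using cd by simp
    also have "\<dots> \<le> 1" using e d by auto
    finally show ?thesis by (simp add: g_def inner_vec3)
  qed
  have "convex {Y. g \<bullet> Y \<le> 1}" by (rule convex_halfspace_le)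
  note hull = hull_minimal[where S = convex, OF _ this]
  have fan_le: "g \<bullet> Y \<le> 1" if Y: "Y \<in> L" "Y $ 1 = 0" "0 \<le> Y $ 2" for Y
  proof -
    have "0 \<le> Y $ 1" "Y $ 1 \<le> Y $ 2" using Y by auto
    then obtain \<delta> where d: "\<delta> \<in> {1, - 1}" "Y \<in> sector d Q (- \<zeta>) \<delta>"
      by (rule aligned_polar_pair.sector_cover[OF dual])
    have "convex hull {0, pt s s 0, pt 0 Q (- (d * \<zeta>)), dual_point \<delta>} \<subseteq> {Y. g \<bullet> Y \<le> 1}"
      "convex hull {0, pt s s 0, dual_point \<delta>, pt 0 0 (\<delta> * d)} \<subseteq> {Y. g \<bullet> Y \<le> 1}"
      using dpg[OF d(1)] pg sg eg[OF d(1)] by (intro hull; auto)+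
    then show ?thesis using sector_is_fan_of_equality[OF d(1) z eq] d(2) Y(1) by blast
  qed
  have "g \<bullet> X \<le> 1" if "X \<in> L" for X
  proof -
    have "pt 0 \<bar>X $ 2\<bar> (X $ 3) \<in> L"
      by (rule d2d_symmetric_averages(1)[OF conv(2) sym(2), of "X $ 1"]) (simp add: pt_eta that)
    then have "g \<bullet> pt 0 \<bar>X $ 2\<bar> (X $ 3) \<le> 1" using fan_le by simp
    moreover have "u * X $ 2 \<le> u * \<bar>X $ 2\<bar>" using u by (intro mult_left_mono) auto
    ultimately show ?thesis by (simp add: g_def inner_vec3)
  qed
  then have "g \<in> K" unfolding pol(2)[symmetric] polar_body_def by blast
  then show False using pointed u(1) by (simp add: g_def)
qed

text \<open>
  Otherwise \<open>K\<close> and \<open>L\<close> both have a pointed end, and the two resulting volumes multiply to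
  \<open>1 = 36 * V 1 * W 1 = (t * s) * (c * d) * (P * Q) = (1 + \<zeta>\<^sup>2) / 2\<close>.
\<close>

lemma extremal_imp_zeta_unit:
  assumes eq: "measure lebesgue K * measure lebesgue L = 64 / 9"
  shows "\<bar>\<zeta>\<bar> = 1"
proof (rule ccontr)
  assume "\<bar>\<zeta>\<bar> \<noteq> 1"
  then have z: "\<bar>\<zeta>\<bar> < 1" "\<bar>- \<zeta>\<bar> < 1" using zeta by auto
  have eq': "measure lebesgue L * measure lebesgue K = 64 / 9" using eq by (simp add: mult.commute)
  obtain \<epsilon> where e: "\<epsilon> \<in> {1, - 1}" "\<And>u. 0 < u \<Longrightarrow> pt 0 u (\<epsilon> * d) \<notin> L"
    using dual_no_flat_end[OF z(1) eq] by blast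
  obtain \<delta> where d: "\<delta> \<in> {1, - 1}" "\<And>u. 0 < u \<Longrightarrow> pt 0 u (\<delta> * c) \<notin> K"
    using aligned_polar_pair.dual_no_flat_end[OF dual z(2) eq'] by blast
  have "6 * V 1 = t * c * P" by (rule volume_of_pointed_end[OF z(1) eq d])
  moreover have "t * s = 1 / 2" using ts by simp
  moreover have "6 * W 1 = s * d * Q" by (rule aligned_polar_pair.volume_of_pointed_end[OF dual z(2) eq' e])
  ultimately have "36 * (V 1 * W 1) = (t * s) * (c * d) * (P * Q)" by algebra
  moreover have "V 1 * W 1 = 1 / 36" using volume_product_eqD[OF eq] by blast
  ultimately have "1 + \<zeta>\<^sup>2 = 2" unfolding cd PQ \<open>t * s = 1 / 2\<close> by simp
  then show False using z(1) by (auto simp: power2_eq_1_iff)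
qed

text \<open>
  The images of \<open>(0, P, c * \<zeta>)\<close> under the group span a tetrahedron inside \<open>K\<close>, and the images
  of the paired point in \<open>L\<close> give the four inequalities that define this same tetrahedron, as
  \<open>P * Q = 2\<close>.
\<close>

lemma extremal_is_tetrahedron:
  assumes z: "\<bar>\<zeta>\<bar> = 1"
  shows "K = (\<lambda>X. pt (P * X $ 1) (P * X $ 2) (c * \<zeta> * X $ 3)) ` std_tetrahedron"
    (is "K = ?D ` _")
proof
  have z2: "\<zeta> * \<zeta> = 1" using z by (metis abs_mult_self_eq mult_1)
  have PQ2: "P * Q = 2" using PQ z2 by (simp add: power2_eq_square)
  have a: "pt 0 (- P) (c * \<zeta>) \<in> K" "pt P 0 (- (c * \<zeta>)) \<in> K"
    using d2d_symmetricD(2,3)[OF sym(1) memK(2)] by simp_all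
  have b: "pt (- P) 0 (- (c * \<zeta>)) \<in> K" using d2d_symmetricD(1)[OF sym(1) a(2)] .
  have lin: "linear ?D" by (auto intro!: linearI simp: pt_ops algebra_simps)
  have "?D ` std_tetrahedron = convex hull {pt 0 P (c * \<zeta>), pt 0 (- P) (c * \<zeta>),
      pt P 0 (- (c * \<zeta>)), pt (- P) 0 (- (c * \<zeta>))}"
    unfolding std_tetrahedron_def convex_hull_linear_image[OF lin] by simp
  also have "\<dots> \<subseteq> K" using a b memK(2) by (intro hull_minimal conv) auto
  finally show "?D ` std_tetrahedron \<subseteq> K" .
  have a': "pt 0 (- Q) (- (d * \<zeta>)) \<in> L" "pt Q 0 (d * \<zeta>) \<in> L"
    using d2d_symmetricD(2,3)[OF sym(2) memL(2)] by simp_all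
  have b': "pt (- Q) 0 (d * \<zeta>) \<in> L" using d2d_symmetricD(1)[OF sym(2) a'(2)] .
  show "K \<subseteq> ?D ` std_tetrahedron"
  proof
    fix X assume "X \<in> K"
    then have X: "pt (X $ 1) (X $ 2) (X $ 3) \<in> K" by (simp add: pt_eta)
    define h where "h = X $ 3 * (d * \<zeta>)"
    define Y where "Y = pt (X $ 1 * Q / 2) (X $ 2 * Q / 2) h"
    have "X $ 2 * Q \<le> 1 + h" "- (X $ 2) * Q \<le> 1 + h" "X $ 1 * Q \<le> 1 - h" "- (X $ 1) * Q \<le> 1 - h"
      using pairing[OF X memL(2)] pairing[OF X a'(1)] pairing[OF X a'(2)] pairing[OF X b']
      by (simp_all add: h_def)
    then have "Y \<in> std_tetrahedron" by (auto simp: Y_def std_tetrahedron_iff abs_le_iff)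
    moreover have "X = ?D Y"
    proof -
      have "c * \<zeta> * h = X $ 3 * (c * d) * (\<zeta> * \<zeta>)" by (simp add: h_def algebra_simps)
      then have hz: "c * \<zeta> * h = X $ 3" unfolding cd z2 by simp
      have PQx: "P * (x * Q / 2) = x" for x
      proof -
        have "P * (x * Q / 2) = (P * Q) * (x / 2)" by simp
        then show ?thesis unfolding PQ2 by simp
      qed
      show ?thesis unfolding Y_def vector_3 PQx hz by (rule pt_eta[symmetric])
    qed
    ultimately show "X \<in> ?D ` std_tetrahedron" by (rule rev_image_eqI)
  qed
qed

end

section \<open>Aligning an invariant body with its polar\<close>

lemma D2d_invariant_imp_d2d_symmetric:
  assumes "invariant_under D2d K"
  shows "d2d_symmetric K"
proof -
  define g where "g = (vector [vector [0, -1, 0], vector [1, 0, 0], vector [0, 0, -1]] :: real^3^3)"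
  define h where "h = (vector [vector [1, 0, 0], vector [0, -1, 0], vector [0, 0, 1]] :: real^3^3)"
  have "g \<in> D2d" "h \<in> D2d"
    unfolding D2d_def g_def h_def by (auto intro: generate.incl)
  then have inv: "g *v X \<in> K" "h *v X \<in> K" if "X \<in> K" for X
    using assms that unfolding invariant_under_def by blast+
  have "g *v pt x y z = pt (- y) x (- z)" "h *v pt x y z = pt x (- y) z" for x y z
    by (simp_all add: g_def h_def vec_eq_iff forall_3 matrix_vector_mult_def sum_3)
  then have gh: "pt (- y) x (- z) \<in> K" "pt x (- y) z \<in> K" if "pt x y z \<in> K" for x y z
    using inv[OF that] by simp_all
  show ?thesis
    unfolding d2d_symmetric_def
  proof (intro allI impI conjI)
    fix x y z assume X: "pt x y z \<in> K"
    show "pt x (- y) z \<in> K" by (rule gh(2)[OF X])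
    show "pt (- x) y z \<in> K" using gh(2)[OF gh(1)[OF gh(1)[OF X]]] by simp
    show "pt y x (- z) \<in> K" using gh(1)[OF gh(2)[OF X]] by simp
  qed
qed

text \<open>
  The interior is again convex and symmetric, so the averages of an interior point over the
  group, which end at the origin, stay in the interior.
\<close>

lemma zero_interior_of_symmetric:
  assumes K: "convex K" "d2d_symmetric K" "interior K \<noteq> {}"
  shows "0 \<in> interior K"
proof -
  have inv: "f X \<in> interior K"
    if f: "linear f" "\<And>X. f (f X) = X" "\<And>X. X \<in> K \<Longrightarrow> f X \<in> K" and X: "X \<in> interior K"
    for f :: "real^3 \<Rightarrow> real^3" and X
  proof -
    have "f ` K = K" using f(2,3) by (metis image_iff subsetI subset_antisym image_subsetI)
    moreover have "inj f" using f(2) by (metis injI)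
    ultimately have "f ` interior K = interior K"
      using interior_injective_linear_image[OF f(1)] by metis
    then show ?thesis using X by blast
  qed
  have sym: "pt (- (X $ 1)) (X $ 2) (X $ 3) \<in> K" "pt (X $ 1) (- (X $ 2)) (X $ 3) \<in> K"
    "pt (X $ 2) (X $ 1) (- (X $ 3)) \<in> K" if "X \<in> K" for X
    using d2d_symmetricD[OF K(2), of "X $ 1" "X $ 2" "X $ 3"] that by (simp_all add: pt_eta)
  have lin: "linear (\<lambda>X. pt (- (X $ 1)) (X $ 2) (X $ 3))" "linear (\<lambda>X. pt (X $ 1) (- (X $ 2)) (X $ 3))"
    "linear (\<lambda>X. pt (X $ 2) (X $ 1) (- (X $ 3)))"
    by (auto intro!: linearI simp: pt_ops)
  have symI: "d2d_symmetric (interior K)"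
    unfolding d2d_symmetric_def
  proof (intro allI impI)
    fix x y z assume X: "pt x y z \<in> interior K"
    show "pt (- x) y z \<in> interior K \<and> pt x (- y) z \<in> interior K \<and> pt y x (- z) \<in> interior K"
      using inv[OF lin(1) _ sym(1) X] inv[OF lin(2) _ sym(2) X] inv[OF lin(3) _ sym(3) X]
      by (simp add: pt_eta)
  qed
  note avg = d2d_symmetric_averages[OF convex_interior[OF K(1)] symI]
  obtain X where "X \<in> interior K" using K(3) by blast
  then have "pt (X $ 1) (X $ 2) (X $ 3) \<in> interior K" by (simp add: pt_eta)
  from avg(3)[OF avg(2)[OF this]] show ?thesis by (simp add: pt_ops(4))
qed

lemma compact_polar_body: "0 \<in> interior K \<Longrightarrow> compact (polar_body K)"
  by (simp add: compact_eq_bounded_closed closed_polar_body bounded_polar_body)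

text \<open>
  The two sides agree at \<open>r = 0\<close>, so their derivatives there satisfy the same inequality.
\<close>

lemma first_order_bound:
  fixes c p q P \<eta> \<theta> :: real
  assumes P: "0 < P"
    and le: "\<And>r. 0 < r \<Longrightarrow> r \<le> 1 \<Longrightarrow>
      (c\<^sup>2 + q\<^sup>2) * (P + r * \<eta>)\<^sup>2 \<le> P\<^sup>2 * (c\<^sup>2 + (q + r * \<theta>)\<^sup>2)"
  shows "(c\<^sup>2 + q\<^sup>2) * \<eta> \<le> P * q * \<theta>"
proof (rule ccontr)
  define A where "A = 2 * P * ((c\<^sup>2 + q\<^sup>2) * \<eta> - P * q * \<theta>)"
  define B where "B = (c\<^sup>2 + q\<^sup>2) * \<eta>\<^sup>2 - P\<^sup>2 * \<theta>\<^sup>2"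
  assume "\<not> ?thesis"
  then have A: "0 < A" using P by (simp add: A_def)
  \<comment> \<open>The difference of the two sides is \<open>r * (A + r * B)\<close>; this \<open>r\<close> is so small that
    \<open>A\<close> outweighs \<open>r * B\<close>.\<close>
  define r where "r = A / (A + \<bar>B\<bar>)"
  have r: "0 < r" "r \<le> 1" using A by (simp_all add: r_def)
  have "r * (A + r * B) = (c\<^sup>2 + q\<^sup>2) * (P + r * \<eta>)\<^sup>2 - P\<^sup>2 * (c\<^sup>2 + (q + r * \<theta>)\<^sup>2)"
    by (simp add: A_def B_def power2_eq_square algebra_simps)
  also have "\<dots> \<le> 0" using le[OF r] by simp
  finally have "A + r * B \<le> 0" using r by (simp add: mult_le_0_iff)
  moreover have "r * \<bar>B\<bar> < A"
  proof -
    have "r * (A + \<bar>B\<bar>) = A" using A by (simp add: r_def)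
    moreover have "0 < r * A" using r A by simp
    ultimately show ?thesis by (simp add: distrib_left)
  qed
  moreover have "- (r * \<bar>B\<bar>) \<le> r * B"
    using r by (metis abs_ge_minus_self abs_mult abs_of_pos minus_le_iff)
  ultimately show False by linarith
qed

text \<open>
  The points on the vertical axis and on the axis of the half-turn come from maximising \<open>z\<close> and
  \<open>x + y\<close> over \<open>K\<close>. Averaging moves a maximiser to the axis without changing the value, and
  the maximal value gives the point of the polar body. In the mirror plane, the condition that the paired points have
  heights of opposite sign, \<open>\<zeta> * c\<close> and \<open>-\<zeta> / c\<close>, is the equation for a critical point of
  \<open>y\<^sup>2 / (c\<^sup>2 + z\<^sup>2)\<close>, so a maximiser of this quotient is used. Convexity of \<open>K\<close> turns the
  first-order condition into the global inequality that defines a point of the polar body.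
\<close>

lemma aligned_polar_pair_exists:
  assumes K: "compact K" "convex K" "interior K \<noteq> {}" "d2d_symmetric K"
  shows "\<exists>c d P Q t s \<zeta>. aligned_polar_pair K (polar_body K) c d P Q t s \<zeta>"
proof -
  have zint: "0 \<in> interior K" by (rule zero_interior_of_symmetric) (use K in auto)
  then have zin: "0 \<in> K" using interior_subset by blast
  obtain e where e: "0 < e" "cball 0 e \<subseteq> K" using zint by (meson mem_interior_cball)
  have axes: "pt e 0 0 \<in> K" "pt 0 e 0 \<in> K" "pt 0 0 e \<in> K"
    using e by (auto intro!: subsetD[OF e(2)] simp: norm_eq_sqrt_inner inner_vec3)
  have ne: "K \<noteq> {}" using zin by blast
  note avg = d2d_symmetric_averages[OF K(2,4)]
  have eta: "X \<in> K \<Longrightarrow> pt (X $ 1) (X $ 2) (X $ 3) \<in> K" for X by (simp add: pt_eta)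

  have "continuous_on K (\<lambda>X. X $ 3)" by (intro continuous_intros)
  then obtain X3 where X3: "X3 \<in> K" "\<And>X. X \<in> K \<Longrightarrow> X $ 3 \<le> X3 $ 3"
    using continuous_attains_sup[OF K(1) ne] by blast
  define c where "c = X3 $ 3"
  have c: "0 < c" using X3(2)[OF axes(3)] e by (simp add: c_def)
  have h: "\<bar>X $ 3\<bar> \<le> c" if "X \<in> K" for X
    using X3(2)[OF that] X3(2)[OF d2d_symmetricD(3)[OF K(4) eta[OF that]]] by (simp add: c_def abs_le_iff)
  have cK: "pt 0 0 c \<in> K" using avg(2)[OF eta[OF X3(1)]] by (simp add: c_def)

  have "continuous_on K (\<lambda>X. X $ 1 + X $ 2)" by (intro continuous_intros)
  then obtain Y where Y: "Y \<in> K" "\<And>X. X \<in> K \<Longrightarrow> X $ 1 + X $ 2 \<le> Y $ 1 + Y $ 2"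
    using continuous_attains_sup[OF K(1) ne] by blast
  define t where "t = (Y $ 1 + Y $ 2) / 2"
  have t: "0 < t" using Y(2)[OF axes(1)] e by (simp add: t_def)
  have tK: "pt t t 0 \<in> K" using avg(3)[OF eta[OF Y(1)]] by (simp add: t_def)

  have dpos: "0 < c\<^sup>2 + (X $ 3)\<^sup>2" for X :: "real^3"
    using c by (simp add: add_pos_nonneg)
  have "continuous_on K (\<lambda>X. (X $ 2)\<^sup>2 / (c\<^sup>2 + (X $ 3)\<^sup>2))"
    using dpos by (intro continuous_intros) (metis less_irrefl)
  then obtain Z where Z: "Z \<in> K"
    "\<And>X. X \<in> K \<Longrightarrow> (X $ 2)\<^sup>2 / (c\<^sup>2 + (X $ 3)\<^sup>2) \<le> (Z $ 2)\<^sup>2 / (c\<^sup>2 + (Z $ 3)\<^sup>2)"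
    using continuous_attains_sup[OF K(1) ne] by meson
  define P where "P = \<bar>Z $ 2\<bar>"
  define q where "q = Z $ 3"
  define \<zeta> where "\<zeta> = q / c"
  define Q where "Q = (1 + \<zeta>\<^sup>2) / P"
  have pK: "pt 0 P q \<in> K" using avg(1)[OF eta[OF Z(1)]] by (simp add: P_def q_def)
  have Z': "(c\<^sup>2 + q\<^sup>2) * (X $ 2)\<^sup>2 \<le> P\<^sup>2 * (c\<^sup>2 + (X $ 3)\<^sup>2)" if "X \<in> K" for X
    using Z(2)[OF that] dpos[of X] dpos[of Z] by (simp add: P_def q_def divide_simps mult.commute)
  have "0 < (c\<^sup>2 + q\<^sup>2) * e\<^sup>2" using e dpos[of Z] by (simp add: q_def)
  also have "\<dots> \<le> P\<^sup>2 * c\<^sup>2" using Z'[OF axes(2)] by simp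
  finally have "P \<noteq> 0" by auto
  then have P: "0 < P" by (simp add: P_def)
  have cz: "c * \<zeta> = q" using c by (simp add: \<zeta>_def)
  have zeta: "\<bar>\<zeta>\<bar> \<le> 1" using h[OF Z(1)] c by (simp add: \<zeta>_def q_def)
  have Q: "0 < Q" "P * Q = 1 + \<zeta>\<^sup>2" using P by (simp_all add: Q_def add_pos_nonneg)

  \<comment> \<open>The tangent line at the maximiser to the curve \<open>y = (P / sqrt (c\<^sup>2 + q\<^sup>2)) * sqrt (c\<^sup>2 + z\<^sup>2)\<close>
    supports the section of \<open>K\<close>.\<close>
  have tangent: "Q * X $ 2 - (1 / c) * \<zeta> * X $ 3 \<le> 1" if X: "X \<in> K" for X
  proof -
    have "(c\<^sup>2 + q\<^sup>2) * (X $ 2 - P) \<le> P * q * (X $ 3 - q)"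
    proof (rule first_order_bound[OF P])
      fix r :: real assume r: "0 < r" "r \<le> 1"
      have "(1 - r) *\<^sub>R pt 0 P q + r *\<^sub>R X \<in> K"
        by (rule convexD[OF K(2) pK X]) (use r in auto)
      from Z'[OF this] show "(c\<^sup>2 + q\<^sup>2) * (P + r * (X $ 2 - P))\<^sup>2 \<le> P\<^sup>2 * (c\<^sup>2 + (q + r * (X $ 3 - q))\<^sup>2)"
        by (simp add: algebra_simps)
    qed
    then have "(c\<^sup>2 + q\<^sup>2) * X $ 2 - P * q * X $ 3 \<le> P * c\<^sup>2"
      by (simp add: algebra_simps power2_eq_square)
    moreover have "(c\<^sup>2 + q\<^sup>2) * X $ 2 - P * q * X $ 3 = (P * c\<^sup>2) * (Q * X $ 2 - (1 / c) * \<zeta> * X $ 3)"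
    proof -
      have "(P * c\<^sup>2) * (Q * X $ 2 - (1 / c) * \<zeta> * X $ 3) = (P * Q) * c\<^sup>2 * X $ 2 - P * (c * \<zeta>) * X $ 3"
        using c by (simp add: algebra_simps power2_eq_square)
      also have "\<dots> = (c\<^sup>2 + (c * \<zeta>)\<^sup>2) * X $ 2 - P * (c * \<zeta>) * X $ 3"
        unfolding Q(2) by (simp add: algebra_simps power_mult_distrib)
      finally show ?thesis unfolding cz by simp
    qed
    ultimately have "(P * c\<^sup>2) * (Q * X $ 2 - (1 / c) * \<zeta> * X $ 3) \<le> (P * c\<^sup>2) * 1" by simp
    then show ?thesis by (rule mult_left_le_imp_le) (use P c in auto)
  qed

  have L: "pt 0 0 (1 / c) \<in> polar_body K" "pt 0 Q (- ((1 / c) * \<zeta>)) \<in> polar_body K"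
    "pt (1 / (2 * t)) (1 / (2 * t)) 0 \<in> polar_body K"
    unfolding polar_body_def
  proof (safe, goal_cases)
    case (1 X)
    then show ?case using X3(2)[OF 1] c by (simp add: inner_vec3 c_def)
  next
    case (2 X)
    then show ?case using tangent[OF 2] by (simp add: inner_vec3)
  next
    case (3 X)
    have "X $ 1 + X $ 2 \<le> 2 * t" using Y(2)[OF 3] by (simp add: t_def)
    then show ?case using t by (simp add: inner_vec3 flip: add_divide_distrib)
  qed
  have "aligned_polar_pair K (polar_body K) c (1 / c) P Q t (1 / (2 * t)) \<zeta>"
    using K c P Q t tK cK pK L zeta convex_polar_body compact_polar_body[OF zint]
      d2d_symmetric_polar[OF K(4)] bipolar[OF compact_imp_closed[OF K(1)] K(2) zin]
    by unfold_locales (simp_all add: cz)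
  then show ?thesis by blast
qed

section \<open>Volume products of linear images and of tetrahedra\<close>

lemma zero_interior_linear_image:
  fixes f :: "real^3 \<Rightarrow> real^3"
  assumes "linear f" "bij f" "0 \<in> interior K"
  shows "0 \<in> interior (f ` K)"
  using interior_injective_linear_image[OF assms(1) bij_is_inj[OF assms(2)], of K] assms(3)
    linear_0[OF assms(1)] by (metis imageI)

lemma volume_product_linear_image:
  assumes f: "linear f" "bij f" and K: "compact K" "0 \<in> interior K"
  shows "vol (f ` K) * vol (polar_body (f ` K)) = vol K * vol (polar_body K)"
proof -
  have "polar_body (f ` K) \<in> lmeasurable"
    by (intro lmeasurable_compact compact_polar_body zero_interior_linear_image f K)
  then have "vol (polar_body K) = \<bar>det (matrix (adjoint f))\<bar> * vol (polar_body (f ` K))"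
    by (subst polar_body_linear_image[OF f, of K]) (rule measure_linear_image[OF adjoint_linear[OF f(1)]])
  moreover have "det (matrix (adjoint f)) = det (matrix f)"
    by (simp add: matrix_adjoint f(1) det_transpose)
  moreover have "vol (f ` K) = \<bar>det (matrix f)\<bar> * vol K"
    by (rule measure_linear_image[OF f(1) lmeasurable_compact[OF K(1)]])
  ultimately show ?thesis by simp
qed

lemma std_tetrahedron_compact: "compact std_tetrahedron"
  unfolding std_tetrahedron_def by (simp add: finite_imp_compact_convex_hull)

lemma std_tetrahedron_interior: "0 \<in> interior std_tetrahedron"
proof (rule interiorI)
  show "open {X :: real^3. \<bar>X $ 2\<bar> < (1 + X $ 3) / 2 \<and> \<bar>X $ 1\<bar> < (1 - X $ 3) / 2}"
    by (intro open_Collect_conj open_Collect_less continuous_intros) auto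
qed (auto simp: std_tetrahedron_iff)

lemma std_tetrahedron_volume: "vol std_tetrahedron = 4 / 3"
proof -
  have "std_tetrahedron = convex hull ((\<lambda>X. pt (- 1) 0 (- 1) + X) ` {0, pt 1 1 2, pt 1 (- 1) 2, pt 2 0 0})"
    unfolding std_tetrahedron_def by (simp add: pt_ops insert_commute)
  also have "\<dots> = (\<lambda>X. pt (- 1) 0 (- 1) + X) ` (convex hull {0, pt 1 1 2, pt 1 (- 1) 2, pt 2 0 0})"
    by (rule convex_hull_translation)
  finally have "vol std_tetrahedron = vol (convex hull {0, pt 1 1 2, pt 1 (- 1) 2, pt 2 0 0})"
    using measure_translation[of "pt (- 1) 0 (- 1)"] by metis
  then show ?thesis by (simp add: measure_tetrahedron triple_product_def)
qed

text \<open>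
  The polar exchanges the directions of the upper and the lower edge; the edges become twice as
  long.
\<close>

lemma std_tetrahedron_polar:
  "polar_body std_tetrahedron = (\<lambda>X. pt (2 * X $ 1) (2 * X $ 2) (- (X $ 3))) ` std_tetrahedron"
    (is "_ = ?f ` _")
proof (intro equalityI subsetI)
  fix Y assume Y: "Y \<in> polar_body std_tetrahedron"
  have v: "pt 0 1 1 \<in> std_tetrahedron" "pt 0 (- 1) 1 \<in> std_tetrahedron"
    "pt 1 0 (- 1) \<in> std_tetrahedron" "pt (- 1) 0 (- 1) \<in> std_tetrahedron"
    by (simp_all add: std_tetrahedron_iff)
  have "pt (Y $ 1 / 2) (Y $ 2 / 2) (- (Y $ 3)) \<in> std_tetrahedron"
    using v[THEN polar_body_inner[OF Y]] by (auto simp: std_tetrahedron_iff inner_vec3 abs_le_iff)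
  moreover have "Y = ?f (pt (Y $ 1 / 2) (Y $ 2 / 2) (- (Y $ 3)))" by (simp add: vec_eq_iff forall_3)
  ultimately show "Y \<in> ?f ` std_tetrahedron" by (rule rev_image_eqI)
next
  fix Y assume "Y \<in> ?f ` std_tetrahedron"
  then obtain X where X: "X \<in> std_tetrahedron" "Y = ?f X" by blast
  have "std_tetrahedron \<subseteq> {W. Y \<bullet> W \<le> 1}"
    unfolding std_tetrahedron_def using X
    by (intro hull_minimal convex_halfspace_le) (auto simp: std_tetrahedron_iff inner_vec3 abs_le_iff)
  then show "Y \<in> polar_body std_tetrahedron" by (auto simp: polar_body_def)
qed

lemma std_tetrahedron_volume_product: "vol std_tetrahedron * vol (polar_body std_tetrahedron) = 64 / 9"
proof -
  let ?f = "\<lambda>X::real^3. pt (2 * X $ 1) (2 * X $ 2) (- (X $ 3))"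
  have lin: "linear ?f" by (auto intro!: linearI simp: pt_ops algebra_simps)
  have "det (matrix ?f) = - 4" by (simp add: det_3 matrix_def axis_def)
  then have "vol (polar_body std_tetrahedron) = 4 * vol std_tetrahedron"
    unfolding std_tetrahedron_polar
    using measure_linear_image[OF lin lmeasurable_compact[OF std_tetrahedron_compact]] by simp
  then show ?thesis by (simp add: std_tetrahedron_volume)
qed

text \<open>
  Send the two upper vertices to \<open>a, b\<close> and the two lower ones to \<open>c, d\<close>; this is consistent
  because both vertex sets sum to zero. The map is injective because a vanishing linear
  combination of the vertices can be shifted by a multiple of \<open>a + b + c + d = 0\<close> to have
  coefficient sum zero, where affine independence applies.
\<close>

lemma centred_simplex_linear_image:
  fixes V :: "(real^3) set"
  assumes V: "card V = 4" "\<not> affine_dependent V" "(\<Sum>v\<in>V. v) = 0"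
  obtains f where "linear f" "bij f" "convex hull V = f ` std_tetrahedron"
proof -
  obtain a b c d where abcd: "V = {a, b, c, d}" "a \<noteq> b" "a \<noteq> c" "a \<noteq> d" "b \<noteq> c" "b \<noteq> d" "c \<noteq> d"
    using V(1) by (auto simp: card_Suc_eq numeral_eq_Suc)
  have s: "a + b + c + d = 0" using V(3) abcd by (simp add: add.assoc)
  define f where "f = (\<lambda>X::real^3. (X $ 1 / 2) *\<^sub>R (c - d) + (X $ 2 / 2) *\<^sub>R (a - b) + (X $ 3 / 2) *\<^sub>R (a + b))"
  have lin: "linear f"
    unfolding f_def by (auto intro!: linearI simp: add_divide_distrib algebra_simps)
  have indep: "\<alpha> = 0 \<and> \<beta> = 0 \<and> \<gamma> = 0 \<and> \<delta> = 0"
    if "\<alpha> + \<beta> + \<gamma> + \<delta> = 0" "\<alpha> *\<^sub>R a + \<beta> *\<^sub>R b + \<gamma> *\<^sub>R c + \<delta> *\<^sub>R d = 0" for \<alpha> \<beta> \<gamma> \<delta>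
  proof -
    define u where "u = (\<lambda>v. if v = a then \<alpha> else if v = b then \<beta> else if v = c then \<gamma> else \<delta>)"
    have "sum u V = 0" "(\<Sum>v\<in>V. u v *\<^sub>R v) = 0"
      using that abcd by (simp_all add: u_def add.assoc)
    then have "\<forall>v\<in>V. u v = 0"
      using V(2) abcd(1) by (subst (asm) affine_dependent_explicit_finite) auto
    then show ?thesis using abcd by (auto simp: u_def)
  qed
  have "inj f"
  proof (rule linear_injective_0[OF lin, THEN iffD2], intro allI impI)
    fix X assume fX: "f X = 0"
    define x y z where "x = X $ 1" and "y = X $ 2" and "z = X $ 3"
    have "(y / 2 + z / 4) *\<^sub>R a + (z / 4 - y / 2) *\<^sub>R b + (x / 2 - z / 4) *\<^sub>R c + (- x / 2 - z / 4) *\<^sub>R d =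
        f X - (z / 4) *\<^sub>R (a + b + c + d)"
    proof -
      have "(z / 2) *\<^sub>R w = (z / 4) *\<^sub>R w + (z / 4) *\<^sub>R w" for w :: "real^3"
        by (simp flip: scaleR_add_left)
      then show ?thesis
        unfolding f_def x_def[symmetric] y_def[symmetric] z_def[symmetric]
        by (simp add: algebra_simps)
    qed
    also have "\<dots> = 0" unfolding fX s by simp
    finally have "y / 2 + z / 4 = 0 \<and> z / 4 - y / 2 = 0 \<and> x / 2 - z / 4 = 0 \<and> - x / 2 - z / 4 = 0"
      by (intro indep) simp_all
    then have "x = 0" "y = 0" "z = 0" by auto
    then show "X = 0" by (simp add: vec_eq_iff forall_3 x_def y_def z_def)
  qed
  then have "bij f" using linear_injective_imp_surjective[OF lin] by (simp add: bij_def)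
  have half: "(1 / 2 :: real) *\<^sub>R w + (1 / 2) *\<^sub>R w = w" for w :: "real^3"
    by (simp flip: scaleR_add_left)
  have e: "a + b = - (c + d)" using s by (simp add: add.assoc add_eq_0_iff2)
  have "f (pt 0 1 1) = a" "f (pt 0 (- 1) 1) = b"
    using half[of a] half[of b] by (simp_all add: f_def algebra_simps)
  moreover have "f (pt 1 0 (- 1)) = c" "f (pt (- 1) 0 (- 1)) = d"
    using half[of c] half[of d] by (simp_all add: f_def e algebra_simps)
  ultimately have "convex hull V = f ` std_tetrahedron"
    unfolding std_tetrahedron_def convex_hull_linear_image[OF lin] abcd(1) by simp
  then show ?thesis using that lin \<open>bij f\<close> by blast
qed

lemma zero_interior_polar_body:
  assumes "bounded K"
  shows "0 \<in> interior (polar_body K)"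
proof -
  obtain B where B: "0 < B" "\<And>x. x \<in> K \<Longrightarrow> norm x \<le> B" using assms bounded_pos by blast
  have "y \<bullet> x \<le> 1" if "norm y < 1 / B" "x \<in> K" for x y
  proof -
    have "y \<bullet> x \<le> norm y * norm x" by (rule norm_cauchy_schwarz)
    also have "\<dots> \<le> 1 / B * B" using that B by (intro mult_mono) auto
    finally show ?thesis using B by simp
  qed
  then have "ball 0 (1 / B) \<subseteq> polar_body K" by (auto simp: polar_body_def)
  then show ?thesis using B by (intro interiorI[of "ball 0 (1 / B)"]) auto
qed

section \<open>The sharp inequality\<close>

theorem corollary1p4:
  fixes K T :: "(real^3) set"
  assumes "K \<in> invariant_convex_bodies D2d"
    and "centred_regular_tetrahedron T"
  shows "vol K * vol (polar_body K) \<ge> vol T * vol (polar_body T) \<and>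
    vol T * vol (polar_body T) = 64 / 9 \<and>
    (vol K * vol (polar_body K) = vol T * vol (polar_body T) \<longleftrightarrow>
       (linear_image_of K T \<or> linear_image_of K (polar_body T)) \<and> invariant_under D2d K)"
proof -
  have K: "compact K" "convex K" "interior K \<noteq> {}" "invariant_under D2d K"
    using assms(1) by (auto simp: invariant_convex_bodies_def convex_body_def)
  obtain c d P Q t s \<zeta> where "aligned_polar_pair K (polar_body K) c d P Q t s \<zeta>"
    using aligned_polar_pair_exists[OF K(1-3) D2d_invariant_imp_d2d_symmetric[OF K(4)]] by blast
  then interpret aligned_polar_pair K "polar_body K" c d P Q t s \<zeta> .
  obtain V where "card V = 4" "\<not> affine_dependent V" "(\<Sum>v\<in>V. v) = 0" and TV: "T = convex hull V"
    using assms(2) unfolding centred_regular_tetrahedron_def by auto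
  then obtain f where f: "linear f" "bij f" "T = f ` std_tetrahedron"
    by (metis centred_simplex_linear_image)
  have prodT: "vol T * vol (polar_body T) = 64 / 9"
    unfolding f(3) volume_product_linear_image[OF f(1,2) std_tetrahedron_compact std_tetrahedron_interior]
    by (rule std_tetrahedron_volume_product)
  have T: "compact T" "0 \<in> interior T" "convex T"
    unfolding f(3)
    by (intro compact_continuous_image std_tetrahedron_compact linear_continuous_on
        linear_conv_bounded_linear[THEN iffD1] f(1)
        zero_interior_linear_image f std_tetrahedron_interior,
        intro zero_interior_linear_image f std_tetrahedron_interior,
        intro convex_linear_image f, simp add: std_tetrahedron_def)
  have bip: "polar_body (polar_body T) = T"
    using T interior_subset by (intro bipolar compact_imp_closed) auto
  have "vol K * vol (polar_body K) = 64 / 9 \<longleftrightarrow> linear_image_of K T \<or> linear_image_of K (polar_body T)"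
  proof
    assume "vol K * vol (polar_body K) = 64 / 9"
    then have z: "\<bar>\<zeta>\<bar> = 1" by (rule extremal_imp_zeta_unit)
    define g where "g = (\<lambda>X::real^3. pt (P * X $ 1) (P * X $ 2) (c * \<zeta> * X $ 3))"
    have g: "linear g" unfolding g_def by (auto intro!: linearI simp: pt_ops algebra_simps)
    have "\<zeta> \<noteq> 0" using z by auto
    then have "inj g"
      using pos by (auto intro!: injI simp: g_def pt_eq_iff vec_eq_iff forall_3)
    then have "bij g" using linear_injective_imp_surjective[OF g] by (simp add: bij_def)
    obtain h where h: "linear h" "\<And>x. h (f x) = x" "\<And>x. f (h x) = x"
      using linear_injective_isomorphism[OF f(1) bij_is_inj[OF f(2)]] by auto
    have "bij h" using h(2,3) by (metis bijI')
    have "K = g ` std_tetrahedron" using extremal_is_tetrahedron[OF z] by (simp add: g_def)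
    also have "\<dots> = (g \<circ> h) ` T" unfolding f(3) by (simp add: image_comp o_def h(2))
    finally have "linear_image_of K T"
      unfolding linear_image_of_def
      using linear_compose[OF h(1) g] bij_comp[OF \<open>bij h\<close> \<open>bij g\<close>] by blast
    then show "linear_image_of K T \<or> linear_image_of K (polar_body T)" ..
  next
    assume "linear_image_of K T \<or> linear_image_of K (polar_body T)"
    then obtain h where h: "linear h" "bij h" "K = h ` T \<or> K = h ` polar_body T"
      unfolding linear_image_of_def by blast
    then show "vol K * vol (polar_body K) = 64 / 9"
      using volume_product_linear_image[OF h(1,2) T(1,2)] prodT bip
        volume_product_linear_image[OF h(1,2) compact_polar_body[OF T(2)]
          zero_interior_polar_body[OF compact_imp_bounded[OF T(1)]]]
      by (auto simp: mult.commute)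
  qed
  then show ?thesis unfolding prodT using volume_product_ge K(4) by blast
qed

end
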